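(* Let $d\ge 2$ be an integer, $k\in\mathbb{N}$ and $p\in[1,\infty)$ with $kp<d$, let $\beta\in\mathbb{R}$, and put $q=\frac{dp}{d-kp}$. There is a constant $C$ depending only on $d,k,p,\beta$ such that for every $\tau>0$ and every smooth compactly supported function $u$ on $\Sigma_\tau\cong\mathbb{R}^d$, $$\tau^{k/d}\,\|u\|_{\mathcal{L}^{q}_{1-q+q(\beta+k)}}\le C\,\|u\|_{\mathcal{W}^{k,p}_{1-p+p\beta}}.$$
   Context: For $\tau>0$ let $\Sigma_\tau=\{(t,x)\in\mathbb{R}^{1+d}: t^2-|x|^2=\tau^2,\ t>0\}$, parametrized by $x\in\mathbb{R}^d$ via $x\mapsto(\sqrt{\tau^2+|x|^2},x)$, and let $w_\tau(x)=\sqrt{\tau^2+|x|^2}$. The induced volume form is $\mathrm{dvol}=\frac{\tau}{w_\tau}\,dx^1\cdots dx^d$. The Lorentz boosts $L^i=x^i\partial_t+t\partial_{x^i}$ are tangent to $\Sigma_\tau$ and act there as $L^i=w_\tau\partial_{x^i}$. For $p\in[1,\infty)$, $\alpha\in\mathbb{R}$, $k\in\mathbb{N}$: $\|u\|_{\mathcal{L}^p_\alpha}=\left(\int_{\Sigma_\tau} w_\tau^\alpha|u|^p\,\mathrm{dvol}\right)^{1/p}$, $\|u\|_{\mathring{\mathcal{W}}^{k,p}_\alpha}=\sum_{i_1,\dots,i_k=1}^d\|L^{i_1}\cdots L^{i_k}u\|_{\mathcal{L}^p_\alpha}$ (with $\mathring{\mathcal W}^{0,p}_\alpha=\mathcal{L}^p_\alpha$),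 and $\|u\|_{\mathcal{W}^{k,p}_\alpha}=\sum_{j=0}^k\|u\|_{\mathring{\mathcal{W}}^{j,p}_\alpha}$. *)

theory Defs
  imports "HOL-Analysis.Analysis"
begin

definition hyperboloid :: "real \<Rightarrow> (real \<times> (real^'n)) set" where
  "hyperboloid \<tau> = {(t, x). t\<^sup>2 - (norm x)\<^sup>2 = \<tau>\<^sup>2 \<and> t > 0}"

definition weight :: "real \<Rightarrow> real^'n \<Rightarrow> real" where
  "weight \<tau> x = sqrt (\<tau>\<^sup>2 + (norm x)\<^sup>2)"

definition hyperboloid_param :: "real \<Rightarrow> real^'n \<Rightarrow> real \<times> (real^'n)" where
  "hyperboloid_param \<tau> x = (weight \<tau> x, x)"

text \<open>
  Functions on the hyperboloid are represented by their pullbacks along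
  \<open>hyperboloid_param \<tau>\<close>, i.e. as functions of \<open>x\<close>. In this representation the
  induced volume form and the boosts are given by the formulas below;
  \<open>boost_param\<close> relates the boosts to the ambient fields \<open>x\<^sup>i \<partial>\<^sub>t + t \<partial>\<^sub>i\<close>.
\<close>

definition partial_deriv :: "'n \<Rightarrow> (real^'n \<Rightarrow> real) \<Rightarrow> real^'n \<Rightarrow> real" where
  "partial_deriv i u x = frechet_derivative u (at x) (axis i 1)"

definition boost :: "real \<Rightarrow> 'n \<Rightarrow> (real^'n \<Rightarrow> real) \<Rightarrow> real^'n \<Rightarrow> real" where
  "boost \<tau> i u x = weight \<tau> x * partial_deriv i u x"

definition hyperboloid_vol :: "real \<Rightarrow> (real^'n) measure" where
  "hyperboloid_vol \<tau> = density lborel (\<lambda>x. ennreal (\<tau> / weight \<tau> x))"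

definition smooth :: "(real^'n \<Rightarrow> real) \<Rightarrow> bool" where
  "smooth u \<longleftrightarrow> (\<forall>is x. foldr partial_deriv is u differentiable at x)"

definition compactly_supported :: "(real^'n \<Rightarrow> real) \<Rightarrow> bool" where
  "compactly_supported u \<longleftrightarrow> compact (closure (support_on UNIV u))"

definition Lnorm :: "real \<Rightarrow> real \<Rightarrow> real \<Rightarrow> (real^'n \<Rightarrow> real) \<Rightarrow> real" where
  "Lnorm \<tau> p \<alpha> u =
     (\<integral>x. weight \<tau> x powr \<alpha> * \<bar>u x\<bar> powr p \<partial>hyperboloid_vol \<tau>) powr (1 / p)"

definition hom_Wnorm :: "real \<Rightarrow> nat \<Rightarrow> real \<Rightarrow> real \<Rightarrow> (real^'n \<Rightarrow> real) \<Rightarrow> real" where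
  "hom_Wnorm \<tau> k p \<alpha> u =
     (\<Sum>is\<in>{is :: 'n list. length is = k}. Lnorm \<tau> p \<alpha> (foldr (boost \<tau>) is u))"

definition Wnorm :: "real \<Rightarrow> nat \<Rightarrow> real \<Rightarrow> real \<Rightarrow> (real^'n \<Rightarrow> real) \<Rightarrow> real" where
  "Wnorm \<tau> k p \<alpha> u = (\<Sum>j\<le>k. hom_Wnorm \<tau> j p \<alpha> u)"

lemma weight_pos: "\<tau> > 0 \<Longrightarrow> weight \<tau> x > 0"
  by (simp add: weight_def add_pos_nonneg)

lemma bij_betw_hyperboloid_param:
  assumes "\<tau> > 0"
  shows "bij_betw (hyperboloid_param \<tau>) UNIV (hyperboloid \<tau>)"
proof -
  have "z \<in> range (hyperboloid_param \<tau>)" if "z \<in> hyperboloid \<tau>" for z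
  proof (cases z)
    case (Pair t x)
    with that have "t\<^sup>2 = \<tau>\<^sup>2 + (norm x)\<^sup>2" "t > 0"
      by (auto simp: hyperboloid_def algebra_simps)
    then have "t = weight \<tau> x"
      by (metis weight_def less_imp_le real_sqrt_unique)
    with Pair show ?thesis by (auto simp: hyperboloid_param_def)
  qed
  moreover have "hyperboloid_param \<tau> x \<in> hyperboloid \<tau>" for x :: "real^'n"
    using weight_pos[OF assms, of x]
    by (auto simp: hyperboloid_def hyperboloid_param_def weight_def)
  ultimately show ?thesis
    by (auto simp: bij_betw_def inj_on_def hyperboloid_param_def)
qed

lemma boost_param:
  fixes F :: "real \<times> (real^'n) \<Rightarrow> real"
  assumes "\<tau> > 0" and F: "F differentiable at (hyperboloid_param \<tau> x)"
  shows "boost \<tau> i (F \<circ> hyperboloid_param \<tau>) x =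
    x $ i * frechet_derivative F (at (hyperboloid_param \<tau> x)) (1, 0) +
    weight \<tau> x * frechet_derivative F (at (hyperboloid_param \<tau> x)) (0, axis i 1)"
proof -
  let ?D = "frechet_derivative F (at (hyperboloid_param \<tau> x))"
  note w = weight_pos[OF assms(1), of x]
  have D: "(F has_derivative ?D) (at (hyperboloid_param \<tau> x))"
    using F by (simp add: frechet_derivative_works)
  then interpret D: bounded_linear ?D by (rule has_derivative_bounded_linear)
  have pos: "\<tau>\<^sup>2 + x \<bullet> x > 0"
    using assms(1) by (simp add: add_pos_nonneg)
  have "((\<lambda>x. sqrt (\<tau>\<^sup>2 + x \<bullet> x)) has_derivative (\<lambda>h. (x \<bullet> h) / sqrt (\<tau>\<^sup>2 + x \<bullet> x))) (at x)"
    using pos by (auto intro!: derivative_eq_intros simp: inner_commute field_simps)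
  then have "((hyperboloid_param \<tau>) has_derivative (\<lambda>h. ((x \<bullet> h) / weight \<tau> x, h))) (at x)"
    unfolding hyperboloid_param_def[abs_def] weight_def[abs_def] power2_norm_eq_inner
    by (intro has_derivative_Pair has_derivative_ident)
  from diff_chain_at[OF this D]
  have "partial_deriv i (F \<circ> hyperboloid_param \<tau>) x = ?D ((x $ i) / weight \<tau> x, axis i 1)"
    by (simp add: partial_deriv_def frechet_derivative_at[symmetric] inner_axis o_def)
  also have "\<dots> = ?D ((x $ i / weight \<tau> x) *\<^sub>R (1, 0) + (0, axis i 1))"
    by simp
  also have "\<dots> = (x $ i / weight \<tau> x) * ?D (1, 0) + ?D (0, axis i 1)"
    by (simp only: D.add D.scaleR real_scaleR_def)
  finally show ?thesis
    using w by (simp add: boost_def field_simps)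
qed

end

theory Submission
  imports Defs
begin

text \<open>
  Write \<open>w = weight \<tau>\<close> and \<open>n\<close> for the dimension. The volume form is \<open>\<tau> / w\<close> times Lebesgue measure, so
  the weighted norm with exponents \<open>p\<close> and \<open>1 - p + p * \<beta>\<close> equals \<open>\<tau> powr (1 / p)\<close> times the ordinary
  Lebesgue norm of \<open>w\<^sup>\<beta>\<^sup>-\<^sup>1 u\<close> (\<open>Lnorm_eq_lebesgue_norm\<close>). As \<open>1 / q = 1 / p - k / n\<close>, the powers of \<open>\<tau>\<close> on the
  two sides agree, and the claim becomes a weighted Sobolev inequality on Euclidean space
  with a constant uniform in the parameter \<open>\<tau>\<close> of the weight.

  For \<open>k = 1\<close> it follows from the Gagliardo-Nirenberg-Sobolev inequality for \<open>w\<^sup>\<beta> u\<close>: the boost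
  is \<open>w \<partial>\<^sub>i\<close> and \<open>\<bar>\<partial>\<^sub>i w\<bar> \<le> 1\<close>, hence the gradient of \<open>w\<^sup>\<beta> u\<close> is controlled by \<open>w\<^sup>\<beta>\<^sup>-\<^sup>1 L\<^sup>i u\<close> and \<open>w\<^sup>\<beta>\<^sup>-\<^sup>1 u\<close>
  (\<open>weighted_sobolev_first_order\<close>). Iteration gives all \<open>k\<close>, the weight gaining one power and the
  exponent improving at each step (\<open>weighted_sobolev_higher_order\<close>).

  The Gagliardo-Nirenberg-Sobolev inequality itself rests on the bound of a function by line integrals
  of its gradient in all coordinate directions. The product of these line integrals is
  integrated by Hoelder's inequality in one coordinate after the other (\<open>grid_lines_inequality\<close>).
  This is the case \<open>p = 1\<close>; applied to a power of the function it yields \<open>1 < p < n\<close>.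
\<close>

section \<open>Powers of extended nonnegative reals\<close>

text \<open>
  The convention \<open>x\<^sup>0 = 1\<close>, also at \<open>0\<close> and \<open>\<infinity>\<close>, makes a factor with exponent zero
  disappear from a product, as a weight zero in Hoelder's inequality demands.
\<close>

definition epowr :: "ennreal \<Rightarrow> real \<Rightarrow> ennreal" where
  "epowr x a = (if a = 0 then 1 else if x = top then top else ennreal (enn2real x powr a))"

lemma epowr_0 [simp]: "epowr x 0 = 1"
  by (simp add: epowr_def)

lemma epowr_zero [simp]: "a \<noteq> 0 \<Longrightarrow> epowr 0 a = 0"
  by (simp add: epowr_def)

lemma epowr_top [simp]: "a \<noteq> 0 \<Longrightarrow> epowr top a = top"
  by (simp add: epowr_def)

lemma epowr_ennreal: "r \<ge> 0 \<Longrightarrow> a \<noteq> 0 \<Longrightarrow> epowr (ennreal r) a = ennreal (r powr a)"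
  by (simp add: epowr_def)

lemma epowr_eq_0_iff: "epowr x a = 0 \<longleftrightarrow> a \<noteq> 0 \<and> x = 0"
  by (auto simp: epowr_def enn2real_eq_0_iff)

lemma epowr_add:
  assumes "a \<ge> 0" "b \<ge> 0"
  shows "epowr x (a + b) = epowr x a * epowr x b"
  using assms
  by (auto simp: epowr_def ennreal_mult[symmetric] powr_add ennreal_mult_top ennreal_top_mult)

lemma epowr_mono:
  assumes "x \<le> y" "a \<ge> 0"
  shows "epowr x a \<le> epowr y a"
  using assms
  by (auto simp: epowr_def top_unique less_top[symmetric] intro!: ennreal_leI powr_mono2 enn2real_mono)

lemma measurable_epowr [measurable]:
  "f \<in> borel_measurable M \<Longrightarrow> (\<lambda>x. epowr (f x) a) \<in> borel_measurable M"
proof -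
  assume [measurable]: "f \<in> borel_measurable M"
  have [measurable]: "{x \<in> space M. f x = top} \<in> sets M"
    using measurable_sets[of f M borel "{top}"] by (simp add: vimage_def Int_def conj_commute)
  show ?thesis unfolding epowr_def by (cases "a = 0") auto
qed

section \<open>Hoelder's inequality for finitely many functions\<close>

lemma weighted_arith_geom_mean:
  fixes x w :: "'i \<Rightarrow> real"
  assumes fin: "finite I" and w: "\<And>i. i \<in> I \<Longrightarrow> w i \<ge> 0" "(\<Sum>i\<in>I. w i) = 1"
    and x: "\<And>i. i \<in> I \<Longrightarrow> x i > 0"
  shows "(\<Prod>i\<in>I. x i powr w i) \<le> (\<Sum>i\<in>I. w i * x i)"
proof -
  have "exp (\<Sum>i\<in>I. w i *\<^sub>R ln (x i)) \<le> (\<Sum>i\<in>I. w i * exp (ln (x i)))"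
    using fin w by (intro convex_on_sum[OF _ _ exp_convex]) auto
  moreover have "exp (\<Sum>i\<in>I. w i *\<^sub>R ln (x i)) = (\<Prod>i\<in>I. x i powr w i)"
    by (subst exp_sum[OF fin], intro prod.cong refl) (use x in \<open>force simp: powr_def\<close>)
  moreover have "(\<Sum>i\<in>I. w i * exp (ln (x i))) = (\<Sum>i\<in>I. w i * x i)"
    by (intro sum.cong refl) (simp add: x)
  ultimately show ?thesis by (simp cong: sum.cong)
qed

text \<open>
  If every integral with positive weight is finite and nonzero, then after division by
  these integrals the weighted arithmetic-geometric mean inequality bounds the product
  pointwise by a convex combination of functions of integral one. A vanishing integral
  makes the left side vanish; in the remaining cases the right side is infinite.
\<close>

lemma nn_integral_Holder:
  fixes f :: "'i \<Rightarrow> 'a \<Rightarrow> ennreal"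
  assumes fin: "finite I" and w: "\<And>i. i \<in> I \<Longrightarrow> w i \<ge> 0" "(\<Sum>i\<in>I. w i) = 1"
    and [measurable]: "\<And>i. i \<in> I \<Longrightarrow> f i \<in> borel_measurable M"
  shows "(\<integral>\<^sup>+x. (\<Prod>i\<in>I. epowr (f i x) (w i)) \<partial>M) \<le> (\<Prod>i\<in>I. epowr (\<integral>\<^sup>+x. f i x \<partial>M) (w i))"
proof -
  define F where "F i = (\<integral>\<^sup>+x. f i x \<partial>M)" for i
  consider (zero) i where "i \<in> I" "w i > 0" "F i = 0"
    | (top) i where "i \<in> I" "w i > 0" "F i = top" "\<And>j. j \<in> I \<Longrightarrow> w j > 0 \<Longrightarrow> F j \<noteq> 0"
    | (fin) "\<And>i. i \<in> I \<Longrightarrow> w i > 0 \<Longrightarrow> F i \<noteq> 0 \<and> F i \<noteq> top"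
    by blast
  then show ?thesis
  proof cases
    case zero
    have "AE x in M. f i x = 0"
      using zero by (simp add: F_def nn_integral_0_iff_AE)
    then have "AE x in M. (\<Prod>i\<in>I. epowr (f i x) (w i)) = 0"
      by eventually_elim (use zero fin in \<open>auto simp: epowr_eq_0_iff intro!: prod_zero bexI[of _ i]\<close>)
    then have "(\<integral>\<^sup>+x. (\<Prod>i\<in>I. epowr (f i x) (w i)) \<partial>M) = (\<integral>\<^sup>+x. 0 \<partial>M)"
      by (rule nn_integral_cong_AE)
    then show ?thesis by simp
  next
    case top
    have "(\<Prod>j\<in>I-{i}. epowr (F j) (w j)) \<noteq> 0"
      using top fin w(1) by (auto simp: epowr_eq_0_iff) (metis less_eq_real_def)
    then have "(\<Prod>j\<in>I. epowr (F j) (w j)) = top"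
      using top fin by (simp add: prod.remove[of I i] ennreal_top_mult)
    then show ?thesis by (simp add: F_def)
  next
    case fin
    define J where "J = {i\<in>I. w i > 0}"
    define G where "G i = enn2real (F i)" for i
    have J: "finite J" "J \<subseteq> I" by (auto simp: J_def assms(1))
    have red: "(\<Prod>i\<in>I. epowr (h i) (w i)) = (\<Prod>i\<in>J. epowr (h i) (w i))" for h
      using w(1) assms(1) by (intro prod.mono_neutral_right) (force simp: J_def)+
    have sumJ: "(\<Sum>i\<in>J. w i) = 1"
      using w assms(1) by (subst w(2)[symmetric], intro sum.mono_neutral_left) (force simp: J_def)+
    have G: "G i > 0" "F i = ennreal (G i)" if "i \<in> J" for i
      using fin[of i] that by (auto simp: J_def G_def enn2real_positive_iff less_top zero_less_iff_neq_zero)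
    have wJ: "w i > 0" if "i \<in> J" for i using that by (simp add: J_def)
    have pw: "(\<Prod>i\<in>J. epowr (f i x) (w i)) \<le>
        (\<Prod>i\<in>J. epowr (F i) (w i)) * (\<Sum>i\<in>J. ennreal (w i / G i) * f i x)" (is "?l \<le> ?c * ?s") for x
    proof -
      consider (a) i where "i \<in> J" "f i x = 0" | (b) i where "i \<in> J" "f i x = top"
        | (c) "\<And>i. i \<in> J \<Longrightarrow> f i x \<noteq> 0 \<and> f i x \<noteq> top" by blast
      then show ?thesis
      proof cases
        case a
        have "?l = 0" using J a wJ[of i] by (intro prod_zero bexI[of _ i]) auto
        then show ?thesis by (metis zero_le)
      next
        case b
        have "?s = top"
          using b J G(1)[of i] wJ[of i]
          by (auto simp: sum.remove[of J i] ennreal_mult_top)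
        moreover have "?c \<noteq> 0"
          using G(2) J ennreal_eq_0_iff[of "G _"] G(1) by (fastforce simp: epowr_eq_0_iff)
        ultimately show ?thesis by (metis ennreal_mult_top top_greatest)
      next
        case c
        define g where "g i = enn2real (f i x)" for i
        have g: "g i > 0" "f i x = ennreal (g i)" if "i \<in> J" for i
          using c[OF that] by (auto simp: g_def enn2real_positive_iff less_top zero_less_iff_neq_zero)
        have "(\<Prod>i\<in>J. g i powr w i) = (\<Prod>i\<in>J. G i powr w i) * (\<Prod>i\<in>J. (g i / G i) powr w i)"
          unfolding prod.distrib[symmetric]
          using g(1) G(1) by (intro prod.cong refl) (metis nonzero_mult_div_cancel_left less_imp_le
              less_irrefl powr_mult times_divide_eq_right divide_nonneg_pos)
        also have "\<dots> \<le> (\<Prod>i\<in>J. G i powr w i) * (\<Sum>i\<in>J. w i * (g i / G i))"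
          using J g(1) G(1) wJ sumJ
          by (intro mult_left_mono weighted_arith_geom_mean prod_nonneg) (auto simp: less_imp_le)
        finally have *: "(\<Prod>i\<in>J. g i powr w i) \<le> (\<Prod>i\<in>J. G i powr w i) * (\<Sum>i\<in>J. w i / G i * g i)"
          by simp
        have "?l = (\<Prod>i\<in>J. ennreal (g i powr w i))"
          using g wJ by (intro prod.cong) (auto simp: epowr_ennreal less_imp_le less_imp_neq[symmetric])
        also have "\<dots> = ennreal (\<Prod>i\<in>J. g i powr w i)" by (simp add: prod_ennreal)
        also have "\<dots> \<le> ennreal ((\<Prod>i\<in>J. G i powr w i) * (\<Sum>i\<in>J. w i / G i * g i))"
          using * by (rule ennreal_leI)
        also have "\<dots> = ennreal (\<Prod>i\<in>J. G i powr w i) * ennreal (\<Sum>i\<in>J. w i / G i * g i)"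
          using g G wJ by (intro ennreal_mult) (auto intro!: prod_nonneg sum_nonneg simp: less_imp_le)
        also have "ennreal (\<Prod>i\<in>J. G i powr w i) = (\<Prod>i\<in>J. ennreal (G i powr w i))"
          by (simp add: prod_ennreal)
        also have "\<dots> = ?c"
          using G wJ by (intro prod.cong) (auto simp: epowr_ennreal less_imp_le less_imp_neq[symmetric])
        also have "ennreal (\<Sum>i\<in>J. w i / G i * g i) = (\<Sum>i\<in>J. ennreal (w i / G i * g i))"
          using g G wJ by (intro sum_ennreal[symmetric]) (auto simp: less_imp_le)
        also have "\<dots> = ?s"
          by (intro sum.cong refl) (metis ennreal_mult divide_nonneg_pos less_imp_le g G wJ)
        finally show ?thesis .
      qed
    qed
    have "(\<integral>\<^sup>+x. (\<Prod>i\<in>I. epowr (f i x) (w i)) \<partial>M)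
        \<le> (\<integral>\<^sup>+x. (\<Prod>i\<in>J. epowr (F i) (w i)) * (\<Sum>i\<in>J. ennreal (w i / G i) * f i x) \<partial>M)"
      unfolding red by (intro nn_integral_mono pw)
    also have "\<dots> = (\<Prod>i\<in>J. epowr (F i) (w i)) * (\<Sum>i\<in>J. ennreal (w i / G i) * F i)"
      using J by (auto simp: nn_integral_cmult nn_integral_sum F_def subset_iff)
    also have "(\<Sum>i\<in>J. ennreal (w i / G i) * F i) = (\<Sum>i\<in>J. ennreal (w i))"
      using G wJ by (intro sum.cong) (auto simp: ennreal_mult'[symmetric] less_imp_neq[symmetric] less_imp_le)
    also have "\<dots> = 1"
      using wJ sumJ by (subst sum_ennreal) (auto simp: less_imp_le)
    finally show ?thesis by (simp add: red F_def)
  qed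
qed

section \<open>The inequality of Gagliardo for line integrals\<close>

text \<open>
  Induction on the index set integrates out one coordinate \<open>i\<close> at a time. With \<open>k\<close> the
  number of the other coordinates, the factor belonging to \<open>i\<close> does not depend on the
  \<open>i\<close>-th coordinate, and Hoelder's inequality with weights \<open>1 - k * p\<close> for \<open>f\<close> and \<open>p\<close> for each of
  the \<open>k\<close> other factors moves the integral over that coordinate inside. What remains is
  the left side for the function \<open>F x = \<integral> f (x(i := t)) dt\<close> and one coordinate fewer. The
  power of \<open>f\<close> is present for the sake of this induction: for \<open>p = 1 / (card I - 1)\<close> its exponent is
  zero, and the inequality bounds the integral of the product of the line integrals alone.
\<close>

lemma (in product_sigma_finite) grid_lines_inequality:
  assumes "finite I" "p > 0" "(real (card I) - 1) * p \<le> 1"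
    and "f \<in> borel_measurable (Pi\<^sub>M I M)"
  shows "(\<integral>\<^sup>+x. epowr (f x) (1 - (real (card I) - 1) * p) *
            (\<Prod>i\<in>I. epowr (\<integral>\<^sup>+t. f (x(i := t)) \<partial>M i) p) \<partial>Pi\<^sub>M I M)
         \<le> epowr (\<integral>\<^sup>+x. f x \<partial>Pi\<^sub>M I M) (1 + p)"
  using assms(1,3,4)
proof (induction I arbitrary: f rule: finite_induct)
  case empty
  then show ?case
    by (simp add: PiM_empty nn_integral_count_space_finite)
next
  case (insert i S f)
  note [measurable] = insert.prems(2)
  define k where "k = real (card S)"
  have k: "k * p \<le> 1" "k \<ge> 0" and card: "real (card (insert i S)) - 1 = k"
    using insert by (auto simp: k_def)
  define F where "F x = (\<integral>\<^sup>+t. f (x(i := t)) \<partial>M i)" for x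
  have F_meas [measurable]: "F \<in> borel_measurable (Pi\<^sub>M S M)"
    unfolding F_def by measurable
  have step: "(\<integral>\<^sup>+y. epowr (f (x(i := y))) (1 - k * p) *
        (\<Prod>j\<in>insert i S. epowr (\<integral>\<^sup>+t. f (x(i := y, j := t)) \<partial>M j) p) \<partial>M i)
      \<le> epowr (F x) (1 - (k - 1) * p) * (\<Prod>j\<in>S. epowr (\<integral>\<^sup>+t. F (x(j := t)) \<partial>M j) p)"
    (is "?L \<le> _") if x: "x \<in> space (Pi\<^sub>M S M)" for x
  proof -
    define g where "g j y = (if j = i then f (x(i := y)) else (\<integral>\<^sup>+t. f (x(i := y, j := t)) \<partial>M j))" for j y
    define w where "w j = (if j = i then 1 - k * p else p)" for j
    have upd [measurable]: "(\<lambda>y. x(i := y)) \<in> measurable (M i) (Pi\<^sub>M (insert i S) M)"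
      using x insert.hyps by (intro measurable_component_update) auto
    have upd2: "(\<lambda>(y, t). x(i := y, j := t)) \<in> measurable (M i \<Otimes>\<^sub>M M j) (Pi\<^sub>M (insert i S) M)" if "j \<in> S" for j
      unfolding case_prod_beta
      by (rule measurable_fun_upd[where J = "insert i S"]) (use that in auto)
    have upd3: "(\<lambda>(y, t). f (x(i := y, j := t))) \<in> borel_measurable (M i \<Otimes>\<^sub>M M j)" if "j \<in> S" for j
      using measurable_comp[OF upd2[OF that] insert.prems(2)] by (simp add: comp_def case_prod_beta)
    have g_meas: "g j \<in> borel_measurable (M i)" if "j \<in> insert i S" for j
    proof (cases "j = i")
      case False
      then have "j \<in> S" using that by simp
      then show ?thesis
        using False upd3[of j] unfolding g_def by (simp add: borel_measurable_nn_integral)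
    next
      case True
      have "(\<lambda>y. f (x(i := y))) \<in> borel_measurable (M i)" by measurable
      with True show ?thesis by (simp add: g_def[abs_def])
    qed
    have w: "\<And>j. w j \<ge> 0" "(\<Sum>j\<in>insert i S. w j) = 1"
    proof -
      show "w j \<ge> 0" for j using k assms(2) by (simp add: w_def)
      have "(\<Sum>j\<in>S. w j) = (\<Sum>j\<in>S. p)" 
        using insert.hyps by (intro sum.cong) (auto simp: w_def)
      then show "(\<Sum>j\<in>insert i S. w j) = 1"
        using insert.hyps by (simp add: w_def k_def)
    qed
    have "?L = (\<integral>\<^sup>+y. epowr (F x) p * (\<Prod>j\<in>insert i S. epowr (g j y) (w j)) \<partial>M i)"
    proof (intro nn_integral_cong)
      fix y
      have "(\<Prod>j\<in>S. epowr (\<integral>\<^sup>+t. f (x(i := y, j := t)) \<partial>M j) p) = (\<Prod>j\<in>S. epowr (g j y) (w j))"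
        using insert.hyps by (intro prod.cong) (auto simp: g_def w_def)
      then show "epowr (f (x(i := y))) (1 - k * p) *
        (\<Prod>j\<in>insert i S. epowr (\<integral>\<^sup>+t. f (x(i := y, j := t)) \<partial>M j) p) =
        epowr (F x) p * (\<Prod>j\<in>insert i S. epowr (g j y) (w j))"
        using insert.hyps by (simp add: F_def g_def w_def mult_ac)
    qed
    also have "\<dots> = epowr (F x) p * (\<integral>\<^sup>+y. (\<Prod>j\<in>insert i S. epowr (g j y) (w j)) \<partial>M i)"
      using g_meas by (intro nn_integral_cmult borel_measurable_prod_ennreal measurable_epowr) auto
    also have "\<dots> \<le> epowr (F x) p * (\<Prod>j\<in>insert i S. epowr (\<integral>\<^sup>+y. g j y \<partial>M i) (w j))"
      using w g_meas insert.hyps by (intro mult_left_mono nn_integral_Holder) auto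
    also have "\<dots> = epowr (F x) p * epowr (F x) (1 - k * p) *
        (\<Prod>j\<in>S. epowr (\<integral>\<^sup>+y. g j y \<partial>M i) (w j))"
      using insert.hyps by (simp add: g_def w_def F_def mult_ac)
    also have "epowr (F x) p * epowr (F x) (1 - k * p) = epowr (F x) (1 - (k - 1) * p)"
      using k assms(2) by (subst epowr_add[symmetric]) (auto simp: algebra_simps)
    also have "(\<Prod>j\<in>S. epowr (\<integral>\<^sup>+y. g j y \<partial>M i) (w j)) =
        (\<Prod>j\<in>S. epowr (\<integral>\<^sup>+t. F (x(j := t)) \<partial>M j) p)"
    proof (intro prod.cong refl)
      fix j assume j: "j \<in> S"
      interpret P: pair_sigma_finite "M i" "M j" ..
      from j have "j \<noteq> i" using insert.hyps by auto
      then have "(\<integral>\<^sup>+y. g j y \<partial>M i) = (\<integral>\<^sup>+y. \<integral>\<^sup>+t. f (x(i := y, j := t)) \<partial>M j \<partial>M i)"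
        by (simp add: g_def)
      also have "\<dots> = (\<integral>\<^sup>+t. \<integral>\<^sup>+y. f (x(i := y, j := t)) \<partial>M i \<partial>M j)"
        using upd3[OF j] by (rule P.Fubini'[symmetric])
      also have "\<dots> = (\<integral>\<^sup>+t. F (x(j := t)) \<partial>M j)"
        using \<open>j \<noteq> i\<close> by (simp add: F_def fun_upd_twist)
      finally show "epowr (\<integral>\<^sup>+y. g j y \<partial>M i) (w j) = epowr (\<integral>\<^sup>+t. F (x(j := t)) \<partial>M j) p"
        using \<open>j \<noteq> i\<close> by (simp add: w_def)
    qed
    finally show ?thesis .
  qed
  have meas: "(\<lambda>x. \<integral>\<^sup>+t. f (x(j := t)) \<partial>M j) \<in> borel_measurable (Pi\<^sub>M (insert i S) M)" if j: "j \<in> insert i S" for j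
  proof -
    have "(\<lambda>(x, t). x(j := t)) \<in> measurable (Pi\<^sub>M (insert i S) M \<Otimes>\<^sub>M M j) (Pi\<^sub>M (insert i S) M)"
      unfolding case_prod_beta
      by (rule measurable_fun_upd[where J = "insert i S"]) (use j in auto)
    from measurable_comp[OF this insert.prems(2)] show ?thesis
      by (intro borel_measurable_nn_integral) (simp add: comp_def case_prod_beta)
  qed
  have "(\<integral>\<^sup>+x. epowr (f x) (1 - k * p) *
          (\<Prod>j\<in>insert i S. epowr (\<integral>\<^sup>+t. f (x(j := t)) \<partial>M j) p) \<partial>Pi\<^sub>M (insert i S) M)
      = (\<integral>\<^sup>+x. \<integral>\<^sup>+y. epowr (f (x(i := y))) (1 - k * p) *
        (\<Prod>j\<in>insert i S. epowr (\<integral>\<^sup>+t. f (x(i := y, j := t)) \<partial>M j) p) \<partial>M i \<partial>Pi\<^sub>M S M)"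
    using insert.hyps meas
    by (intro product_nn_integral_insert borel_measurable_times_ennreal
          borel_measurable_prod_ennreal measurable_epowr) auto
  also have "\<dots> \<le> (\<integral>\<^sup>+x. epowr (F x) (1 - (k - 1) * p) *
      (\<Prod>j\<in>S. epowr (\<integral>\<^sup>+t. F (x(j := t)) \<partial>M j) p) \<partial>Pi\<^sub>M S M)"
    by (intro nn_integral_mono step)
  also have "\<dots> \<le> epowr (\<integral>\<^sup>+x. F x \<partial>Pi\<^sub>M S M) (1 + p)"
    using k assms(2) unfolding k_def by (intro insert.IH F_meas) (auto simp: algebra_simps)
  also have "(\<integral>\<^sup>+x. F x \<partial>Pi\<^sub>M S M) = (\<integral>\<^sup>+x. f x \<partial>Pi\<^sub>M (insert i S) M)"
    unfolding F_def using insert.hyps by (intro product_nn_integral_insert[symmetric]) auto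
  finally show ?case unfolding card .
qed

section \<open>The Gagliardo-Nirenberg-Sobolev inequality\<close>

lemma abs_le_nn_integral_deriv:
  fixes h h' g :: "real \<Rightarrow> real"
  assumes der: "\<And>t. (h has_real_derivative h' t) (at t)" and cont: "continuous_on UNIV h'"
    and g: "\<And>t. \<bar>h' t\<bar> \<le> g t" and vanish: "\<And>t. t < a \<Longrightarrow> h t = 0"
  shows "ennreal \<bar>h s\<bar> \<le> (\<integral>\<^sup>+t. ennreal (g t) \<partial>lborel)"
proof -
  define c where "c = min s (a - 1)"
  have c: "c \<le> s" "h c = 0" by (auto simp: c_def vanish)
  have cont': "continuous_on {c..s} h'" using cont continuous_on_subset by blast
  have "(\<integral>t. indicator {c..s} t *\<^sub>R h' t \<partial>lborel) = h s - h c"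
  proof (rule integral_FTC_atLeastAtMost[OF c(1) _ cont'])
    show "(h has_vector_derivative h' t) (at t within {c..s})" for t
      using der[of t] by (simp add: has_real_derivative_iff_has_vector_derivative has_vector_derivative_at_within)
  qed
  then have "ennreal \<bar>h s\<bar> = ennreal (norm (\<integral>t. indicator {c..s} t *\<^sub>R h' t \<partial>lborel))"
    using c by simp
  also have "\<dots> \<le> (\<integral>\<^sup>+t. ennreal (norm (indicator {c..s} t *\<^sub>R h' t)) \<partial>lborel)"
    using borel_integrable_atLeastAtMost'[OF cont']
    by (intro integral_norm_bound_ennreal) (simp add: set_integrable_def)
  also have "\<dots> \<le> (\<integral>\<^sup>+t. ennreal (g t) \<partial>lborel)"
    using g order_trans[OF abs_ge_zero g]
    by (intro nn_integral_mono ennreal_leI) (auto simp: indicator_def)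
  finally show ?thesis .
qed

text \<open>
  By the fundamental theorem of calculus \<open>\<bar>v x\<bar>\<close> is at most the integral of \<open>G\<close> along the line
  through \<open>x\<close> in each of the \<open>n\<close> coordinate directions. The product of the \<open>n\<close> bounds, raised to
  the power \<open>1 / (n - 1)\<close>, is integrated by the grid lines inequality.
\<close>

lemma gagliardo_nirenberg_one:
  fixes v :: "'a::euclidean_space \<Rightarrow> real" and D :: "'a \<Rightarrow> 'a \<Rightarrow> real" and G :: "'a \<Rightarrow> real"
  defines "n \<equiv> real DIM('a)"
  assumes n: "DIM('a) \<ge> 2"
    and der: "\<And>x. (v has_derivative D x) (at x)"
    and cont: "\<And>b. b \<in> Basis \<Longrightarrow> continuous_on UNIV (\<lambda>x. D x b)"
    and supp: "\<And>x. norm x > R \<Longrightarrow> v x = 0"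
    and G: "\<And>x b. b \<in> Basis \<Longrightarrow> \<bar>D x b\<bar> \<le> G x"
    and G_meas [measurable]: "G \<in> borel_measurable borel"
  shows "(\<integral>\<^sup>+x. ennreal (\<bar>v x\<bar> powr (n / (n - 1))) \<partial>lborel)
       \<le> epowr (\<integral>\<^sup>+x. ennreal (G x) \<partial>lborel) (n / (n - 1))"
proof -
  define e :: "('a \<Rightarrow> real) \<Rightarrow> 'a" where "e f = (\<Sum>b\<in>Basis. f b *\<^sub>R b)" for f
  define P :: "('a \<Rightarrow> real) measure" where "P = Pi\<^sub>M Basis (\<lambda>_. lborel)"
  interpret product_sigma_finite "\<lambda>_::'a. lborel::real measure" ..
  define p where "p = 1 / (n - 1)"
  have n2: "n \<ge> 2" using n by (simp add: n_def)
  have p: "p > 0" "n * p = n / (n - 1)" "1 + p = n / (n - 1)" "(n - 1) * p = 1"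
    using n2 by (auto simp: p_def field_simps)
  have e_meas [measurable]: "e \<in> measurable P borel"
    unfolding e_def P_def by measurable
  have lb: "lborel = distr P borel e"
    unfolding P_def e_def[abs_def] by (rule lborel_eq)
  have v_meas [measurable]: "v \<in> borel_measurable borel"
    using der by (intro borel_measurable_continuous_onI)
      (meson continuous_at_imp_continuous_on has_derivative_continuous)
  have pointwise: "ennreal (\<bar>v (e f)\<bar> powr (n / (n - 1)))
      \<le> (\<Prod>b\<in>Basis. epowr (\<integral>\<^sup>+t. ennreal (G (e (f(b := t)))) \<partial>lborel) p)" for f
  proof -
    have line: "ennreal \<bar>v (e f)\<bar> \<le> (\<integral>\<^sup>+t. ennreal (G (e (f(b := t)))) \<partial>lborel)" if b: "b \<in> Basis" for b
    proof -
      have e_upd: "e (f(b := t)) = e f + (t - f b) *\<^sub>R b" for t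
      proof -
        have "e (f(b := t)) = (\<Sum>c\<in>Basis - {b}. f c *\<^sub>R c) + t *\<^sub>R b"
          using b by (simp add: e_def sum.remove[of _ b])
        moreover have "e f = (\<Sum>c\<in>Basis - {b}. f c *\<^sub>R c) + f b *\<^sub>R b"
          using b by (simp add: e_def sum.remove[of _ b])
        ultimately show ?thesis by (simp add: algebra_simps)
      qed
      define h where "h t = v (e f + (t - f b) *\<^sub>R b)" for t
      have hder: "(h has_real_derivative D (e f + (t - f b) *\<^sub>R b) b) (at t)" for t
      proof -
        have lin: "linear (D (e f + (t - f b) *\<^sub>R b))"
          using der has_derivative_linear by blast
        have "((\<lambda>t. e f + (t - f b) *\<^sub>R b) has_derivative (\<lambda>s. s *\<^sub>R b)) (at t)"
          by (auto intro!: derivative_eq_intros)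
        from diff_chain_at[OF this der]
        have "(h has_derivative (\<lambda>s. D (e f + (t - f b) *\<^sub>R b) (s *\<^sub>R b))) (at t)"
          by (simp add: h_def[abs_def] comp_def)
        then show ?thesis
          by (simp add: has_field_derivative_def linear_cmul[OF lin] mult.commute[of _ "D _ _"])
      qed
      have hcont: "continuous_on UNIV (\<lambda>t. D (e f + (t - f b) *\<^sub>R b) b)"
        by (rule continuous_on_compose2[OF cont[OF b]]) (auto intro!: continuous_intros)
      have "ennreal \<bar>h (f b)\<bar> \<le> (\<integral>\<^sup>+t. ennreal (G (e f + (t - f b) *\<^sub>R b)) \<partial>lborel)"
      proof (rule abs_le_nn_integral_deriv[OF hder hcont])
        show "\<bar>D (e f + (t - f b) *\<^sub>R b) b\<bar> \<le> G (e f + (t - f b) *\<^sub>R b)" for t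
          using G b by blast
        show "h t = 0" if "t < - R" for t
        proof -
          have "e f \<bullet> b = f b"
            using b by (simp add: e_def)
          then have "\<bar>t\<bar> = \<bar>(e f + (t - f b) *\<^sub>R b) \<bullet> b\<bar>"
            using b by (simp add: inner_add_left)
          also have "\<dots> \<le> norm (e f + (t - f b) *\<^sub>R b)"
            using b by (rule Basis_le_norm)
          finally show ?thesis using that by (simp add: h_def supp)
        qed
      qed
      then show ?thesis by (simp add: h_def e_upd)
    qed
    have "\<bar>v (e f)\<bar> powr (n / (n - 1)) = (\<Prod>b\<in>(Basis::'a set). \<bar>v (e f)\<bar> powr p)"
    proof -
      have "(\<bar>v (e f)\<bar> powr p) ^ DIM('a) = \<bar>v (e f)\<bar> powr (n * p)"
        using n by (cases "v (e f) = 0") (auto simp: n_def powr_power)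
      then show ?thesis by (simp add: p(2))
    qed
    also have "ennreal \<dots> = (\<Prod>b\<in>(Basis::'a set). epowr (ennreal \<bar>v (e f)\<bar>) p)"
      using p by (simp add: epowr_ennreal ennreal_power)
    also have "\<dots> \<le> (\<Prod>b\<in>Basis. epowr (\<integral>\<^sup>+t. ennreal (G (e (f(b := t)))) \<partial>lborel) p)"
      using p line by (intro prod_mono_ennreal epowr_mono) auto
    finally show ?thesis .
  qed
  have "(\<integral>\<^sup>+x. ennreal (\<bar>v x\<bar> powr (n / (n - 1))) \<partial>lborel)
      = (\<integral>\<^sup>+f. ennreal (\<bar>v (e f)\<bar> powr (n / (n - 1))) \<partial>P)"
    by (subst lb, subst nn_integral_distr) auto
  also have "\<dots> \<le> (\<integral>\<^sup>+f. epowr (ennreal (G (e f))) (1 - (real (card (Basis::'a set)) - 1) * p) *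
      (\<Prod>b\<in>Basis. epowr (\<integral>\<^sup>+t. ennreal (G (e (f(b := t)))) \<partial>lborel) p) \<partial>P)"
    using p(4) pointwise by (intro nn_integral_mono) (simp add: n_def)
  also have "\<dots> \<le> epowr (\<integral>\<^sup>+f. ennreal (G (e f)) \<partial>P) (1 + p)"
    unfolding P_def using p e_meas
    by (intro grid_lines_inequality) (auto simp: n_def P_def)
  also have "(\<integral>\<^sup>+f. ennreal (G (e f)) \<partial>P) = (\<integral>\<^sup>+x. ennreal (G x) \<partial>lborel)"
    by (subst lb, subst nn_integral_distr) auto
  finally show ?thesis by (simp add: p)
qed

lemma has_real_derivative_abs_powr:
  fixes \<gamma> :: real
  assumes "\<gamma> > 1"
  shows "((\<lambda>s. \<bar>s\<bar> powr \<gamma>) has_real_derivative \<gamma> * (\<bar>s\<bar> powr (\<gamma> - 1) * sgn s)) (at s)"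
proof -
  consider "s > 0" | "s < 0" | "s = 0" by linarith
  then show ?thesis
  proof cases
    case 1
    have "((\<lambda>s. s powr \<gamma>) has_real_derivative \<gamma> * s powr (\<gamma> - 1)) (at s)"
      using 1 by (auto intro!: derivative_eq_intros simp: powr_diff)
    then show ?thesis
      using 1 by (subst DERIV_cong_ev[OF refl _ refl, where g = "\<lambda>s. s powr \<gamma>"])
        (auto intro!: eventually_mono[OF eventually_gt_at_top] eventually_nhds_in_open[of "{0<..}", THEN eventually_mono])
  next
    case 2
    have "((\<lambda>s. (-s) powr \<gamma>) has_real_derivative - \<gamma> * (-s) powr (\<gamma> - 1)) (at s)"
      using 2 by (auto intro!: derivative_eq_intros simp: powr_diff)
    then show ?thesis
      using 2 by (subst DERIV_cong_ev[OF refl _ refl, where g = "\<lambda>s. (-s) powr \<gamma>"])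
        (auto intro!: eventually_nhds_in_open[of "{..<0}", THEN eventually_mono])
  next
    case 3
    have "((\<lambda>h. \<bar>h\<bar> powr (\<gamma> - 1)) \<longlongrightarrow> 0) (at (0::real))"
      using assms by (auto intro!: tendsto_eq_intros)
    then have "((\<lambda>h. \<bar>h\<bar> powr \<gamma> / h) \<longlongrightarrow> 0) (at (0::real))"
      by (rule Lim_null_comparison[rotated])
         (auto simp: powr_diff eventually_at_filter)
    then show ?thesis
      using 3 assms by (simp add: DERIV_def)
  qed
qed

text \<open>
  The function is, up to a constant, the derivative of \<open>\<bar>s\<bar> powr (a + 1)\<close>. It is continuous
  at the jump of the sign because a positive power vanishes there.
\<close>

lemma continuous_on_abs_powr_sgn:
  fixes a :: real
  assumes "a > 0"
  shows "continuous_on UNIV (\<lambda>s::real. \<bar>s\<bar> powr a * sgn s)"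
proof -
  have "continuous_on UNIV (\<lambda>s::real. max s 0 powr a - max (- s) 0 powr a)"
    using assms by (intro continuous_intros continuous_on_powr') auto
  moreover have "(\<lambda>s::real. max s 0 powr a - max (- s) 0 powr a) = (\<lambda>s. \<bar>s\<bar> powr a * sgn s)"
    by (auto simp: fun_eq_iff sgn_if max_def)
  ultimately show ?thesis by metis
qed

lemma integrable_continuous_bounded_support:
  fixes f :: "'a::euclidean_space \<Rightarrow> real"
  assumes "continuous_on UNIV f" and "\<And>x. norm x > R \<Longrightarrow> f x = 0"
  shows "integrable lborel f"
proof -
  have "integrable lborel (\<lambda>x. indicator (cball 0 R) x *\<^sub>R f x)"
    using assms(1) by (intro borel_integrable_compact) (auto intro: continuous_on_subset)
  also have "(\<lambda>x. indicator (cball 0 R) x *\<^sub>R f x) = f"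
    using assms(2) by (auto simp: fun_eq_iff indicator_def)
  finally show ?thesis .
qed

lemma integral_Holder_two:
  fixes f g :: "'a \<Rightarrow> real"
  assumes "integrable M f" "integrable M g" "integrable M (\<lambda>x. f x powr \<theta> * g x powr (1 - \<theta>))"
    and "\<And>x. f x \<ge> 0" "\<And>x. g x \<ge> 0" and \<theta>: "0 < \<theta>" "\<theta> < 1"
  shows "(\<integral>x. f x powr \<theta> * g x powr (1 - \<theta>) \<partial>M) \<le> (\<integral>x. f x \<partial>M) powr \<theta> * (\<integral>x. g x \<partial>M) powr (1 - \<theta>)"
proof -
  have "(\<integral>\<^sup>+x. (\<Prod>i\<in>UNIV. epowr (ennreal (if i then f x else g x)) (if i then \<theta> else 1 - \<theta>)) \<partial>M)
     \<le> (\<Prod>i\<in>UNIV. epowr (\<integral>\<^sup>+x. ennreal (if i then f x else g x) \<partial>M) (if i then \<theta> else 1 - \<theta>))"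
    using assms by (intro nn_integral_Holder) (auto simp: UNIV_bool)
  then have "ennreal (\<integral>x. f x powr \<theta> * g x powr (1 - \<theta>) \<partial>M) \<le>
      ennreal ((\<integral>x. f x \<partial>M) powr \<theta> * (\<integral>x. g x \<partial>M) powr (1 - \<theta>))"
    using assms by (simp add: UNIV_bool nn_integral_eq_integral epowr_ennreal
        integral_nonneg_AE ennreal_mult[symmetric] mult.commute)
  then show ?thesis by (simp add: ennreal_le_iff)
qed

text \<open>
  For \<open>p > 1\<close> the case of exponent one is applied to \<open>\<bar>v\<bar> powr \<gamma>\<close>, where \<open>\<gamma> = p (n - 1) / (n - p)\<close> is
  chosen such that \<open>\<gamma> n / (n - 1) = q\<close>; then also \<open>\<gamma> - 1 = q (1 - 1 / p)\<close>. Hoelder's inequality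
  splits the integral of \<open>\<bar>v\<bar> powr (\<gamma> - 1) * G\<close> into the integral \<open>A\<close> of \<open>\<bar>v\<bar> powr q\<close>, raised to the
  power \<open>1 - 1 / p\<close>, and the norm of \<open>G\<close>. As \<open>A\<close> is finite, its power can be absorbed on the left.
  For \<open>p = 1\<close> one has \<open>\<gamma> = 1\<close>, and \<open>\<bar>v\<bar>\<close> need not be differentiable, so this case is separate.
\<close>

lemma gagliardo_nirenberg_sobolev:
  fixes v :: "'a::euclidean_space \<Rightarrow> real" and D :: "'a \<Rightarrow> 'a \<Rightarrow> real" and G :: "'a \<Rightarrow> real"
  defines "n \<equiv> real DIM('a)"
  assumes n: "DIM('a) \<ge> 2" and p: "p \<ge> 1" "p < n" and q: "q = n * p / (n - p)"
    and der: "\<And>x. (v has_derivative D x) (at x)"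
    and cont: "\<And>b. b \<in> Basis \<Longrightarrow> continuous_on UNIV (\<lambda>x. D x b)"
    and supp: "\<And>x. norm x > R \<Longrightarrow> v x = 0"
    and G: "\<And>x b. b \<in> Basis \<Longrightarrow> \<bar>D x b\<bar> \<le> G x"
    and G_cont: "continuous_on UNIV G" and G_supp: "\<And>x. norm x > R \<Longrightarrow> G x = 0"
  shows "(\<integral>x. \<bar>v x\<bar> powr q \<partial>lborel) powr (1 / q)
     \<le> p * (n - 1) / (n - p) * (\<integral>x. G x powr p \<partial>lborel) powr (1 / p)"
proof -
  have n2: "n \<ge> 2" using n by (simp add: n_def)
  have q_pos: "q > 0" using p n2 by (simp add: q)
  define A where "A = (\<integral>x. \<bar>v x\<bar> powr q \<partial>lborel)"
  define B where "B = (\<integral>x. G x powr p \<partial>lborel)"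
  define \<gamma> where "\<gamma> = p * (n - 1) / (n - p)"
  have G0: "G x \<ge> 0" for x
  proof -
    obtain b :: 'a where "b \<in> Basis" using nonempty_Basis by blast
    from G[OF this, of x] show ?thesis by linarith
  qed
  have v_cont: "continuous_on UNIV v"
    using der by (meson continuous_at_imp_continuous_on has_derivative_continuous)
  have vpow_cont: "continuous_on UNIV (\<lambda>x. \<bar>v x\<bar> powr a)" if "a > 0" for a
    using that v_cont by (intro continuous_on_powr' continuous_intros) auto
  have vpow_int: "integrable lborel (\<lambda>x. \<bar>v x\<bar> powr a)" if "a > 0" for a
    by (rule integrable_continuous_bounded_support[OF vpow_cont[OF that], of R]) (simp add: supp)
  have Gp_int: "integrable lborel (\<lambda>x. G x powr p)"
    using G_supp G0 p G_cont
    by (intro integrable_continuous_bounded_support[where R = R] continuous_on_powr' continuous_intros) auto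
  have nonneg: "A \<ge> 0" "B \<ge> 0" by (auto simp: A_def B_def)
  have A_eq: "(\<integral>\<^sup>+x. ennreal (\<bar>v x\<bar> powr q) \<partial>lborel) = ennreal A"
    unfolding A_def using vpow_int[OF q_pos] by (rule nn_integral_eq_integral) auto
  have "A powr ((n - 1) / n) \<le> \<gamma> * (A powr (1 - 1 / p) * B powr (1 / p))" if "A \<noteq> 0"
  proof (cases "p = 1")
    case True
    have [simp]: "\<gamma> = 1" using True n2 by (simp add: \<gamma>_def)
    have q': "q = n / (n - 1)" using True q by simp
    have "ennreal A \<le> epowr (\<integral>\<^sup>+x. ennreal (G x) \<partial>lborel) (n / (n - 1))"
      unfolding A_eq[symmetric] q' n_def
      using G_cont
      by (intro gagliardo_nirenberg_one[OF n der cont supp G] borel_measurable_continuous_onI) auto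
    also have "(\<integral>\<^sup>+x. ennreal (G x) \<partial>lborel) = ennreal B"
      unfolding B_def using Gp_int G0 True by (subst nn_integral_eq_integral[symmetric]) auto
    finally have "A \<le> B powr (n / (n - 1))"
      using nonneg n2 by (simp add: epowr_ennreal)
    then have "A powr ((n - 1) / n) \<le> (B powr (n / (n - 1))) powr ((n - 1) / n)"
      using nonneg n2 by (intro powr_mono2) auto
    also have "\<dots> = B"
      using nonneg n2 by (simp add: powr_powr)
    finally show ?thesis using True that nonneg by simp
  next
    case False
    then have p1: "p > 1" using p by simp
    have \<gamma>: "\<gamma> > 1" "\<gamma> * (n / (n - 1)) = q" "\<gamma> - 1 = q * (1 - 1 / p)"
    proof -
      have "p * (n - 1) - (n - p) = n * (p - 1)" by (simp add: algebra_simps)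
      moreover have "n * (p - 1) > 0" using p1 n2 by simp
      ultimately have "p * (n - 1) > n - p" by linarith
      then show "\<gamma> > 1" using p by (simp add: \<gamma>_def)
      show "\<gamma> * (n / (n - 1)) = q" using p n2 by (simp add: \<gamma>_def q)
      show "\<gamma> - 1 = q * (1 - 1 / p)" using p n2 by (simp add: \<gamma>_def q field_simps)
    qed
    define H where "H = (\<integral>x. \<bar>v x\<bar> powr (\<gamma> - 1) * G x \<partial>lborel)"
    have H_cont: "continuous_on UNIV (\<lambda>x. \<bar>v x\<bar> powr (\<gamma> - 1) * G x)"
    proof (rule continuous_on_mult[OF vpow_cont G_cont])
      show "0 < \<gamma> - 1" using \<gamma>(1) by simp
    qed
    have H_int: "integrable lborel (\<lambda>x. \<bar>v x\<bar> powr (\<gamma> - 1) * G x)"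
      using H_cont by (rule integrable_continuous_bounded_support[where R = R]) (simp add: supp)
    have H0: "H \<ge> 0" unfolding H_def using G0 by (intro integral_nonneg_AE) auto
    define w where "w x = \<bar>v x\<bar> powr \<gamma>" for x
    define D' where "D' x h = \<gamma> * (\<bar>v x\<bar> powr (\<gamma> - 1) * sgn (v x)) * D x h" for x h
    have wder: "(w has_derivative D' x) (at x)" for x
      using diff_chain_at[OF der has_real_derivative_abs_powr[OF \<gamma>(1), unfolded has_field_derivative_def]]
      by (simp add: w_def[abs_def] D'_def[abs_def] comp_def)
    have D'_cont: "continuous_on UNIV (\<lambda>x. D' x b)" if "b \<in> Basis" for b
      unfolding D'_def using \<gamma> v_cont cont[OF that]
      by (intro continuous_intros continuous_on_compose2[OF continuous_on_abs_powr_sgn[of "\<gamma> - 1"]]) auto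
    have D'_bound: "\<bar>D' x b\<bar> \<le> \<gamma> * (\<bar>v x\<bar> powr (\<gamma> - 1) * G x)" if "b \<in> Basis" for x b
    proof -
      have "\<bar>sgn (v x)\<bar> * \<bar>D x b\<bar> \<le> 1 * G x"
        using G[OF that, of x] by (intro mult_mono) (auto simp: abs_sgn_eq)
      then have "\<gamma> * \<bar>v x\<bar> powr (\<gamma> - 1) * (\<bar>sgn (v x)\<bar> * \<bar>D x b\<bar>) \<le> \<gamma> * \<bar>v x\<bar> powr (\<gamma> - 1) * (1 * G x)"
        using \<gamma> by (intro mult_left_mono) auto
      then show ?thesis using \<gamma> by (simp add: D'_def abs_mult mult_ac)
    qed
    have "(\<integral>\<^sup>+x. ennreal (\<bar>w x\<bar> powr (n / (n - 1))) \<partial>lborel)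
        \<le> epowr (\<integral>\<^sup>+x. ennreal (\<gamma> * (\<bar>v x\<bar> powr (\<gamma> - 1) * G x)) \<partial>lborel) (n / (n - 1))"
      unfolding n_def
    proof (rule gagliardo_nirenberg_one[OF n wder D'_cont _ D'_bound, where R = R])
      show "w x = 0" if "norm x > R" for x using that supp by (simp add: w_def)
      show "(\<lambda>x. \<gamma> * (\<bar>v x\<bar> powr (\<gamma> - 1) * G x)) \<in> borel_measurable borel"
        by (intro borel_measurable_continuous_onI continuous_on_mult_left H_cont)
    qed
    also have "(\<integral>\<^sup>+x. ennreal (\<bar>w x\<bar> powr (n / (n - 1))) \<partial>lborel) = ennreal A"
      unfolding A_eq[symmetric] using \<gamma>(2) by (simp add: w_def powr_powr)
    also have "(\<integral>\<^sup>+x. ennreal (\<gamma> * (\<bar>v x\<bar> powr (\<gamma> - 1) * G x)) \<partial>lborel) = ennreal (\<gamma> * H)"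
      unfolding H_def using H_int \<gamma> G0 by (subst nn_integral_eq_integral) auto
    finally have "A \<le> (\<gamma> * H) powr (n / (n - 1))"
      using \<gamma> H0 n2 by (simp add: epowr_ennreal)
    then have "A powr ((n - 1) / n) \<le> ((\<gamma> * H) powr (n / (n - 1))) powr ((n - 1) / n)"
      using nonneg n2 by (intro powr_mono2) auto
    also have "\<dots> = \<gamma> * H"
      using \<gamma> H0 n2 by (simp add: powr_powr)
    also have "H \<le> A powr (1 - 1 / p) * B powr (1 / p)"
    proof -
      have eq: "(\<bar>v x\<bar> powr q) powr (1 - 1 / p) * (G x powr p) powr (1 - (1 - 1 / p)) =
          \<bar>v x\<bar> powr (\<gamma> - 1) * G x" for x
        using G0 p1 \<gamma>(3) by (simp add: powr_powr)
      show ?thesis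
        using integral_Holder_two[OF vpow_int[OF q_pos] Gp_int, of "1 - 1 / p"] H_int p1
        unfolding eq by (simp add: H_def A_def B_def)
    qed
    finally show ?thesis using \<gamma> by simp
  qed
  note key = this
  show ?thesis
  proof (cases "A = 0")
    case True
    then show ?thesis using p n2 by (simp add: A_def)
  next
    case False
    have "A powr (1 / q) = A powr ((n - 1) / n) * A powr - (1 - 1 / p)"
    proof -
      have "1 / q = (n - 1) / n + - (1 - 1 / p)"
        using p n2 by (simp add: q field_simps)
      then show ?thesis by (simp add: powr_add)
    qed
    also have "\<dots> \<le> \<gamma> * (A powr (1 - 1 / p) * B powr (1 / p)) * A powr - (1 - 1 / p)"
      using key[OF False] by (intro mult_right_mono) auto
    also have "\<dots> = \<gamma> * B powr (1 / p) * (A powr (1 - 1 / p) * A powr - (1 - 1 / p))"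
      by (simp add: mult_ac)
    also have "A powr (1 - 1 / p) * A powr - (1 - 1 / p) = 1"
      using False by (subst powr_add[symmetric]) simp
    finally show ?thesis by (simp add: A_def B_def \<gamma>_def)
  qed
qed

section \<open>Smooth functions, powers of the weight, and boosts\<close>

lemma partial_deriv_eqI:
  "(u has_derivative D) (at x) \<Longrightarrow> partial_deriv i u x = D (axis i 1)"
  by (simp add: partial_deriv_def frechet_derivative_at[symmetric])

lemma partial_deriv_add:
  assumes "\<And>x. u differentiable at x" "\<And>x. v differentiable at x"
  shows "partial_deriv i (\<lambda>x. u x + v x) = (\<lambda>x. partial_deriv i u x + partial_deriv i v x)"
proof
  fix x
  show "partial_deriv i (\<lambda>x. u x + v x) x = partial_deriv i u x + partial_deriv i v x"
    using partial_deriv_eqI[OF has_derivative_add[OF assms[unfolded frechet_derivative_works]], of i x]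
    by (simp add: partial_deriv_def)
qed

lemma partial_deriv_mult:
  assumes "\<And>x. u differentiable at x" "\<And>x. v differentiable at x"
  shows "partial_deriv i (\<lambda>x. u x * v x) = (\<lambda>x. u x * partial_deriv i v x + partial_deriv i u x * v x)"
proof
  fix x
  show "partial_deriv i (\<lambda>x. u x * v x) x = u x * partial_deriv i v x + partial_deriv i u x * v x"
    using partial_deriv_eqI[OF has_derivative_mult[OF assms[unfolded frechet_derivative_works]], of i x]
    by (simp add: partial_deriv_def)
qed

text \<open>
  Smoothness speaks of iterated partial derivatives of one function, and an induction on
  the iteration needs the product of two functions, whose partial derivatives are sums of
  products. Counting the order and generalizing over the functions makes the induction work.
\<close>

primrec differentiable_upto :: "nat \<Rightarrow> (real^'n \<Rightarrow> real) \<Rightarrow> bool" where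
  "differentiable_upto 0 u \<longleftrightarrow> (\<forall>x. u differentiable at x)"
| "differentiable_upto (Suc m) u \<longleftrightarrow>
     (\<forall>x. u differentiable at x) \<and> (\<forall>i. differentiable_upto m (partial_deriv i u))"

lemma differentiable_upto_iff:
  "differentiable_upto m u \<longleftrightarrow>
     (\<forall>is x. length is \<le> m \<longrightarrow> foldr partial_deriv is u differentiable at x)"
proof (induction m arbitrary: u)
  case (Suc m)
  show ?case
  proof
    assume L: "differentiable_upto (Suc m) u"
    show "\<forall>is x. length is \<le> Suc m \<longrightarrow> foldr partial_deriv is u differentiable at x"
    proof (intro allI impI)
      fix "is" :: "'a list" and x assume "length is \<le> Suc m"
      then show "foldr partial_deriv is u differentiable at x"
        using L Suc.IH by (cases "is" rule: rev_cases) auto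
    qed
  next
    assume R: "\<forall>is x. length is \<le> Suc m \<longrightarrow> foldr partial_deriv is u differentiable at x"
    have "foldr partial_deriv is (partial_deriv i u) differentiable at x" if "length is \<le> m" for i "is" x
      using R[rule_format, of "is @ [i]" x] that by simp
    with R[rule_format, of "[]"] Suc.IH show "differentiable_upto (Suc m) u" by simp
  qed
qed simp

lemma smooth_iff_differentiable_upto: "smooth u \<longleftrightarrow> (\<forall>m. differentiable_upto m u)"
  by (auto simp: smooth_def differentiable_upto_iff)

lemma differentiable_upto_Suc: "differentiable_upto (Suc m) u \<Longrightarrow> differentiable_upto m u"
  by (simp add: differentiable_upto_iff)

lemma differentiable_upto_const: "differentiable_upto m (\<lambda>x. c)"
proof (induction m arbitrary: c)
  case (Suc m)
  have "partial_deriv i (\<lambda>x. c) = (\<lambda>x. 0)" for i :: 'a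
    by (auto simp: fun_eq_iff intro!: partial_deriv_eqI[THEN trans])
  then show ?case using Suc.IH[of 0] by simp
qed simp

lemma differentiable_upto_component: "differentiable_upto m (\<lambda>x::real^'n. x $ i)"
proof -
  have der: "((\<lambda>x::real^'n. x $ i) has_derivative (\<lambda>h. h $ i)) (at x)" for x
    by (rule bounded_linear_imp_has_derivative) (rule bounded_linear_vec_nth)
  then have "partial_deriv j (\<lambda>x. x $ i) = (\<lambda>x. axis j 1 $ i)" for j
    by (auto simp: fun_eq_iff intro!: partial_deriv_eqI[THEN trans])
  then show ?thesis
    using der by (cases m) (auto simp: differentiable_def differentiable_upto_const)
qed

lemma differentiable_upto_add:
  "differentiable_upto m u \<Longrightarrow> differentiable_upto m v \<Longrightarrow> differentiable_upto m (\<lambda>x. u x + v x)"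
proof (induction m arbitrary: u v)
  case (Suc m)
  then show ?case by (simp add: partial_deriv_add)
qed simp

lemma differentiable_upto_mult:
  "differentiable_upto m u \<Longrightarrow> differentiable_upto m v \<Longrightarrow> differentiable_upto m (\<lambda>x. u x * v x)"
proof (induction m arbitrary: u v)
  case (Suc m)
  have "differentiable_upto m u" "differentiable_upto m v"
    using Suc.prems differentiable_upto_Suc by blast+
  with Suc show ?case
    by (simp add: partial_deriv_mult differentiable_upto_add)
qed simp

lemma has_derivative_weight_powr:
  assumes "\<tau> > 0"
  shows "((\<lambda>x. weight \<tau> x powr a) has_derivative
    (\<lambda>h. a * ((x \<bullet> h) * weight \<tau> x powr (a - 2)))) (at (x :: real^'n))"
proof -
  have pos: "\<tau>\<^sup>2 + x \<bullet> x > 0"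
    using assms by (simp add: add_pos_nonneg)
  have w: "weight \<tau> x > 0" using weight_pos[OF assms] .
  have "((\<lambda>x. sqrt (\<tau>\<^sup>2 + x \<bullet> x)) has_derivative (\<lambda>h. (x \<bullet> h) / sqrt (\<tau>\<^sup>2 + x \<bullet> x))) (at x)"
    using pos by (auto intro!: derivative_eq_intros simp: inner_commute field_simps)
  then have "(weight \<tau> has_derivative (\<lambda>h. (x \<bullet> h) / weight \<tau> x)) (at x)"
    unfolding weight_def[abs_def] power2_norm_eq_inner .
  moreover have "((\<lambda>s. s powr a) has_derivative (*) (a * weight \<tau> x powr (a - 1))) (at (weight \<tau> x))"
    using has_real_derivative_powr[OF w, of a] by (simp add: has_field_derivative_def)
  ultimately have "((\<lambda>x. weight \<tau> x powr a) has_derivative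
      (\<lambda>h. a * weight \<tau> x powr (a - 1) * ((x \<bullet> h) / weight \<tau> x))) (at x)"
    using diff_chain_at[of "weight \<tau>" _ x] by (fastforce simp: comp_def)
  moreover have "weight \<tau> x powr (a - 2) = weight \<tau> x powr (a - 1) / weight \<tau> x"
    using w powr_diff[of "weight \<tau> x" "a - 1" 1] by simp
  ultimately show ?thesis by (simp add: mult_ac)
qed

lemma partial_deriv_weight_powr:
  assumes "\<tau> > 0"
  shows "partial_deriv i (\<lambda>x. weight \<tau> x powr a) = (\<lambda>x. a * (x $ i * weight \<tau> x powr (a - 2)))"
  by (rule ext, subst partial_deriv_eqI[OF has_derivative_weight_powr[OF assms]])
     (simp add: inner_axis)

text \<open>
  All exponents are treated at once since differentiation lowers the exponent by two.
\<close>

lemma differentiable_upto_weight_powr: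
  assumes "\<tau> > 0"
  shows "differentiable_upto m (\<lambda>x. weight \<tau> x powr a)"
proof (induction m arbitrary: a)
  case 0
  show ?case using has_derivative_weight_powr[OF assms] by (auto simp: differentiable_def)
next
  case (Suc m)
  show ?case using has_derivative_weight_powr[OF assms]
    by (auto simp: differentiable_def partial_deriv_weight_powr[OF assms]
        intro!: differentiable_upto_mult differentiable_upto_const differentiable_upto_component Suc)
qed

lemma smooth_const: "smooth (\<lambda>x. c)"
  by (simp add: smooth_iff_differentiable_upto differentiable_upto_const)

lemma smooth_mult: "smooth u \<Longrightarrow> smooth v \<Longrightarrow> smooth (\<lambda>x. u x * v x)"
  by (simp add: smooth_iff_differentiable_upto differentiable_upto_mult)

lemma smooth_weight_powr: "\<tau> > 0 \<Longrightarrow> smooth (\<lambda>x. weight \<tau> x powr a)"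
  by (simp add: smooth_iff_differentiable_upto differentiable_upto_weight_powr)

lemma smooth_partial_deriv: "smooth u \<Longrightarrow> smooth (partial_deriv i u)"
  unfolding smooth_iff_differentiable_upto by (metis differentiable_upto.simps(2))

lemma smooth_boost:
  assumes "\<tau> > 0" "smooth u"
  shows "smooth (boost \<tau> i u)"
proof -
  have "boost \<tau> i u = (\<lambda>x. weight \<tau> x powr 1 * partial_deriv i u x)"
    by (rule ext) (simp add: boost_def weight_pos[OF assms(1)] less_imp_le)
  then show ?thesis
    using assms smooth_mult smooth_weight_powr smooth_partial_deriv by metis
qed

lemma smooth_imp_differentiable: "smooth u \<Longrightarrow> u differentiable at x"
  unfolding smooth_iff_differentiable_upto by (metis differentiable_upto.simps(1))

lemma smooth_imp_continuous: "smooth u \<Longrightarrow> continuous_on S u"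
  by (meson smooth_imp_differentiable continuous_at_imp_continuous_on differentiable_imp_continuous_within)

lemma compactly_supported_iff: "compactly_supported u \<longleftrightarrow> (\<exists>R. \<forall>x. norm x > R \<longrightarrow> u x = 0)"
proof -
  have "compactly_supported u \<longleftrightarrow> bounded (support_on UNIV u)"
    by (simp add: compactly_supported_def compact_closure)
  also have "\<dots> \<longleftrightarrow> (\<exists>R. \<forall>x. norm x > R \<longrightarrow> u x = 0)"
    unfolding bounded_iff support_on_def by (auto simp: not_less[symmetric])
  finally show ?thesis .
qed

lemma compactly_supported_mult: "compactly_supported u \<Longrightarrow> compactly_supported (\<lambda>x. w x * u x)"
  by (auto simp: compactly_supported_iff)

lemma compactly_supported_partial_deriv:
  assumes "compactly_supported u"
  shows "compactly_supported (partial_deriv i u)"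
proof -
  obtain R where R: "\<And>x. norm x > R \<Longrightarrow> u x = 0"
    using assms by (auto simp: compactly_supported_iff)
  have "partial_deriv i u x = 0" if "norm x > R" for x
  proof -
    have "open (- cball 0 R)" by (simp add: open_Compl)
    then have "(u has_derivative (\<lambda>_. 0)) (at x)"
      by (rule has_derivative_transform_within_open[OF has_derivative_const[of 0]])
         (use that R in auto)
    then show ?thesis by (rule partial_deriv_eqI)
  qed
  then show ?thesis by (auto simp: compactly_supported_iff)
qed

lemma compactly_supported_boost: "compactly_supported u \<Longrightarrow> compactly_supported (boost \<tau> i u)"
  unfolding boost_def[abs_def] by (intro compactly_supported_mult compactly_supported_partial_deriv)

lemma smooth_compactly_supported_boosts:
  assumes "\<tau> > 0" "smooth u" "compactly_supported u"
  shows "smooth (foldr (boost \<tau>) is u)" "compactly_supported (foldr (boost \<tau>) is u)"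
  using assms by (induction "is") (auto intro: smooth_boost compactly_supported_boost)

section \<open>The norms on the hyperboloid as weighted Lebesgue norms\<close>

definition lebesgue_norm :: "real \<Rightarrow> ('a::euclidean_space \<Rightarrow> real) \<Rightarrow> real" where
  "lebesgue_norm p f = (\<integral>x. \<bar>f x\<bar> powr p \<partial>lborel) powr (1 / p)"

lemma lebesgue_norm_nonneg [simp]: "lebesgue_norm p f \<ge> 0"
  by (simp add: lebesgue_norm_def)

lemma lebesgue_norm_cmult:
  assumes "p > 0"
  shows "lebesgue_norm p (\<lambda>x. c * f x) = \<bar>c\<bar> * lebesgue_norm p f"
proof -
  have "(\<integral>x. \<bar>c * f x\<bar> powr p \<partial>lborel) = \<bar>c\<bar> powr p * (\<integral>x. \<bar>f x\<bar> powr p \<partial>lborel)"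
    by (simp add: abs_mult powr_mult)
  then show ?thesis
    using assms by (simp add: lebesgue_norm_def powr_mult powr_powr)
qed

lemma integrable_abs_powr:
  fixes f :: "real^'n \<Rightarrow> real"
  assumes "continuous_on UNIV f" "compactly_supported f" "p > 0"
  shows "integrable lborel (\<lambda>x. \<bar>f x\<bar> powr p)"
proof -
  obtain R where R: "\<And>x. norm x > R \<Longrightarrow> f x = 0"
    using assms(2) by (auto simp: compactly_supported_iff)
  show ?thesis
    using assms by (intro integrable_continuous_bounded_support[where R = R] continuous_on_powr' continuous_intros)
      (auto simp: R)
qed

text \<open>
  Each summand is at most the largest one. Together with the next lemma this
  takes the place of Minkowski's inequality, at the price of a constant.
\<close>

lemma sum_powr_le:
  fixes a :: "'i \<Rightarrow> real"
  assumes "finite I" "r \<ge> 0" "\<And>i. i \<in> I \<Longrightarrow> a i \<ge> 0"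
  shows "(\<Sum>i\<in>I. a i) powr r \<le> real (card I) powr r * (\<Sum>i\<in>I. a i powr r)"
proof (cases "I = {}")
  case False
  define m where "m = Max (a ` I)"
  have "m \<in> a ` I" unfolding m_def using assms(1) False by (intro Max_in) auto
  then obtain j where j: "j \<in> I" "m = a j" by blast
  have "(\<Sum>i\<in>I. a i) \<le> (\<Sum>i\<in>I. m)"
    using assms(1) by (intro sum_mono) (auto simp: m_def)
  then have "(\<Sum>i\<in>I. a i) \<le> real (card I) * m" by simp
  then have "(\<Sum>i\<in>I. a i) powr r \<le> (real (card I) * m) powr r"
    using assms by (intro powr_mono2 sum_nonneg) auto
  also have "\<dots> = real (card I) powr r * m powr r"
    using assms j by (simp add: powr_mult)
  also have "m powr r \<le> (\<Sum>i\<in>I. a i powr r)"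
    unfolding j(2) using assms(1) j(1) by (intro member_le_sum) auto
  finally show ?thesis by (simp add: mult_left_mono)
qed simp

lemma lebesgue_norm_sum_le:
  fixes g :: "'i \<Rightarrow> real^'n \<Rightarrow> real"
  assumes "finite I" "p > 0"
    and "\<And>i. i \<in> I \<Longrightarrow> continuous_on UNIV (g i)" "\<And>i. i \<in> I \<Longrightarrow> compactly_supported (g i)"
  shows "(\<integral>x. (\<Sum>i\<in>I. \<bar>g i x\<bar>) powr p \<partial>lborel) powr (1 / p)
     \<le> real (card I) * real (card I) powr (1 / p) * (\<Sum>i\<in>I. lebesgue_norm p (g i))"
proof -
  have int: "integrable lborel (\<lambda>x. \<bar>g i x\<bar> powr p)" if "i \<in> I" for i
    using that assms by (intro integrable_abs_powr) auto
  have "(\<integral>x. (\<Sum>i\<in>I. \<bar>g i x\<bar>) powr p \<partial>lborel)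
      \<le> (\<integral>x. real (card I) powr p * (\<Sum>i\<in>I. \<bar>g i x\<bar> powr p) \<partial>lborel)"
    using assms int by (intro integral_mono' sum_powr_le) (auto intro!: mult_nonneg_nonneg sum_nonneg)
  also have "\<dots> = real (card I) powr p * (\<Sum>i\<in>I. \<integral>x. \<bar>g i x\<bar> powr p \<partial>lborel)"
    using int by simp
  finally have "(\<integral>x. (\<Sum>i\<in>I. \<bar>g i x\<bar>) powr p \<partial>lborel) powr (1 / p)
      \<le> (real (card I) powr p * (\<Sum>i\<in>I. \<integral>x. \<bar>g i x\<bar> powr p \<partial>lborel)) powr (1 / p)"
    using assms(2) by (intro powr_mono2) auto
  also have "\<dots> = real (card I) * (\<Sum>i\<in>I. \<integral>x. \<bar>g i x\<bar> powr p \<partial>lborel) powr (1 / p)"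
    using assms(2) by (simp add: powr_mult powr_powr sum_nonneg)
  also have "\<dots> \<le> real (card I) * (real (card I) powr (1 / p) * (\<Sum>i\<in>I. lebesgue_norm p (g i)))"
    unfolding lebesgue_norm_def using assms(1,2) by (intro mult_left_mono sum_powr_le) auto
  finally show ?thesis by (simp add: mult.assoc)
qed

text \<open>
  The factor \<open>\<tau> / weight \<tau> x\<close> of the volume form cancels the \<open>1\<close> in the exponent
  \<open>1 - p + p * \<beta>\<close>, so that \<open>\<tau>\<close> enters only through the weight and one power of \<open>\<tau>\<close>.
\<close>

lemma Lnorm_eq_lebesgue_norm:
  fixes u :: "real^'n \<Rightarrow> real"
  assumes "\<tau> > 0" "p > 0" and [measurable]: "u \<in> borel_measurable borel"
  shows "Lnorm \<tau> p (1 - p + p * \<beta>) u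
     = \<tau> powr (1 / p) * lebesgue_norm p (\<lambda>x. weight \<tau> x powr (\<beta> - 1) * u x)"
proof -
  have [measurable]: "weight \<tau> \<in> borel_measurable (borel :: (real^'n) measure)"
    unfolding weight_def[abs_def] by measurable
  have eq: "\<tau> / weight \<tau> x * (weight \<tau> x powr (1 - p + p * \<beta>) * \<bar>u x\<bar> powr p)
      = \<tau> * \<bar>weight \<tau> x powr (\<beta> - 1) * u x\<bar> powr p" for x
  proof -
    have w: "weight \<tau> x > 0" using weight_pos[OF assms(1)] .
    have "weight \<tau> x powr (1 - p + p * \<beta>) = weight \<tau> x powr (1 + (\<beta> - 1) * p)"
      by (simp add: algebra_simps)
    also have "\<dots> = weight \<tau> x * (weight \<tau> x powr (\<beta> - 1)) powr p"
      using w by (simp add: powr_add powr_powr)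
    finally show ?thesis
      using w by (simp add: abs_mult powr_mult)
  qed
  have "(\<integral>x. weight \<tau> x powr (1 - p + p * \<beta>) * \<bar>u x\<bar> powr p \<partial>hyperboloid_vol \<tau>)
     = (\<integral>x. (\<tau> / weight \<tau> x) *\<^sub>R (weight \<tau> x powr (1 - p + p * \<beta>) * \<bar>u x\<bar> powr p) \<partial>lborel)"
    unfolding hyperboloid_vol_def
    using assms(1) weight_pos[OF assms(1)]
    by (intro integral_density AE_I2) (auto intro!: divide_nonneg_pos)
  also have "\<dots> = \<tau> * (\<integral>x. \<bar>weight \<tau> x powr (\<beta> - 1) * u x\<bar> powr p \<partial>lborel)"
    by (simp only: real_scaleR_def eq integral_mult_right_zero)
  finally show ?thesis
    using assms by (simp add: Lnorm_def lebesgue_norm_def powr_mult)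
qed

section \<open>Weighted Sobolev inequalities\<close>

text \<open>
  Since \<open>\<partial>\<^sub>i (w\<^sup>\<beta> f) = w\<^sup>\<beta>\<^sup>-\<^sup>1 L\<^sup>i f + \<beta> (x\<^sub>i / w) w\<^sup>\<beta>\<^sup>-\<^sup>1 f\<close> for the weight \<open>w\<close>, and \<open>\<bar>x\<^sub>i\<bar> \<le> w\<close>, the
  gradient of \<open>w\<^sup>\<beta> f\<close> is bounded uniformly in \<open>\<tau>\<close> by the functions on the right. These are
  indexed by an option type: \<open>None\<close> for the term without derivative, \<open>Some i\<close> for the boosts.
\<close>

lemma weighted_sobolev_first_order:
  fixes p \<beta> q :: real
  defines "n \<equiv> real CARD('n::finite)"
  assumes n: "CARD('n) \<ge> 2" and p: "p \<ge> 1" "p < n" and q: "q = n * p / (n - p)"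
  shows "\<exists>C\<ge>0. \<forall>\<tau>>0. \<forall>f :: real^'n \<Rightarrow> real. smooth f \<and> compactly_supported f \<longrightarrow>
    lebesgue_norm q (\<lambda>x. weight \<tau> x powr \<beta> * f x) \<le>
      C * (lebesgue_norm p (\<lambda>x. weight \<tau> x powr (\<beta> - 1) * f x) +
           (\<Sum>i\<in>UNIV. lebesgue_norm p (\<lambda>x. weight \<tau> x powr (\<beta> - 1) * boost \<tau> i f x)))"
proof -
  define N where "N = real (card (UNIV :: 'n option set))"
  define K where "K = p * (n - 1) / (n - p) * (N * N powr (1 / p))"
  define C where "C = K * (\<bar>\<beta>\<bar> + 1)"
  have n2: "n \<ge> 2" using n by (simp add: n_def)
  have K: "K \<ge> 0" using p n2 by (auto simp: K_def N_def intro!: mult_nonneg_nonneg divide_nonneg_nonneg)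
  have main: "lebesgue_norm q (\<lambda>x. weight \<tau> x powr \<beta> * f x) \<le>
      C * (lebesgue_norm p (\<lambda>x. weight \<tau> x powr (\<beta> - 1) * f x) +
           (\<Sum>i\<in>UNIV. lebesgue_norm p (\<lambda>x. weight \<tau> x powr (\<beta> - 1) * boost \<tau> i f x)))"
    if \<tau>: "\<tau> > 0" and f: "smooth f" "compactly_supported f" for \<tau> and f :: "real^'n \<Rightarrow> real"
  proof -
    note w = weight_pos[OF \<tau>]
    define v where "v x = weight \<tau> x powr \<beta> * f x" for x
    define g where "g j x = (case j of None \<Rightarrow> \<beta> * (weight \<tau> x powr (\<beta> - 1) * f x)
      | Some i \<Rightarrow> weight \<tau> x powr (\<beta> - 1) * boost \<tau> i f x)" for j x
    have v: "smooth v"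
      unfolding v_def[abs_def] using \<tau> f by (intro smooth_mult smooth_weight_powr)
    have g_cont: "continuous_on UNIV (g j)" for j
      unfolding g_def[abs_def] using \<tau> f
      by (cases j) (auto intro!: smooth_imp_continuous smooth_mult smooth_const
          smooth_weight_powr smooth_boost)
    have g_supp: "compactly_supported (g j)" for j
      unfolding g_def[abs_def] using f
      by (cases j) (auto intro!: compactly_supported_mult compactly_supported_boost)
    have v_supp: "compactly_supported v"
      unfolding v_def[abs_def] using f by (intro compactly_supported_mult)
    have "\<exists>R. \<forall>j x. norm x > R \<longrightarrow> v x = 0 \<and> g j x = 0"
    proof -
      obtain S where S: "\<And>x. norm x > S \<Longrightarrow> v x = 0"
        using v_supp by (auto simp: compactly_supported_iff)
      obtain T where T: "\<And>j x. norm x > T j \<Longrightarrow> g j x = 0"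
        using g_supp by (simp add: compactly_supported_iff) metis
      have "T j \<le> Max (range T)" for j by simp
      then have "norm x > max S (Max (range T)) \<Longrightarrow> v x = 0 \<and> g j x = 0" for j x
        using S T[of j x] by (meson le_less_trans max_less_iff_conj)
      then show ?thesis by blast
    qed
    then obtain R where R: "\<And>x. norm x > R \<Longrightarrow> v x = 0" "\<And>j x. norm x > R \<Longrightarrow> g j x = 0"
      by blast
    have dv: "partial_deriv i v x = g (Some i) x + (x $ i / weight \<tau> x) * g None x" for i x
    proof -
      have "partial_deriv i v x = weight \<tau> x powr \<beta> * partial_deriv i f x +
          \<beta> * (x $ i * weight \<tau> x powr (\<beta> - 2)) * f x"
        unfolding v_def[abs_def] using \<tau> f
        by (simp add: partial_deriv_mult smooth_imp_differentiable smooth_weight_powr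
            partial_deriv_weight_powr)
      moreover have "weight \<tau> x powr \<beta> = weight \<tau> x powr (\<beta> - 1) * weight \<tau> x"
        using w[of x] by (simp add: powr_diff)
      moreover have "weight \<tau> x powr (\<beta> - 2) = weight \<tau> x powr (\<beta> - 1) / weight \<tau> x"
        using w[of x] powr_diff[of "weight \<tau> x" "\<beta> - 1" 1] by simp
      ultimately show ?thesis by (simp add: g_def boost_def)
    qed
    have dv_le: "\<bar>partial_deriv i v x\<bar> \<le> (\<Sum>j\<in>UNIV. \<bar>g j x\<bar>)" for i x
    proof -
      have "\<bar>x $ i\<bar> \<le> norm x" by (rule component_le_norm_cart)
      also have "norm x \<le> weight \<tau> x"
        unfolding weight_def by (rule real_le_rsqrt) simp
      finally have "\<bar>x $ i / weight \<tau> x\<bar> \<le> 1" using w[of x] by (simp add: abs_divide)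
      then have "\<bar>(x $ i / weight \<tau> x) * g None x\<bar> \<le> 1 * \<bar>g None x\<bar>"
        unfolding abs_mult by (intro mult_right_mono) auto
      then have "\<bar>partial_deriv i v x\<bar> \<le> \<bar>g (Some i) x\<bar> + \<bar>g None x\<bar>"
        unfolding dv by linarith
      also have "\<dots> = (\<Sum>j\<in>{Some i, None}. \<bar>g j x\<bar>)" by simp
      also have "\<dots> \<le> (\<Sum>j\<in>UNIV. \<bar>g j x\<bar>)" by (intro sum_mono2) auto
      finally show ?thesis .
    qed
    have "lebesgue_norm q v \<le> p * (n - 1) / (n - p) *
        (\<integral>x. (\<Sum>j\<in>UNIV. \<bar>g j x\<bar>) powr p \<partial>lborel) powr (1 / p)"
    proof -
      have *: "\<exists>i. b = axis i 1" if "b \<in> Basis" for b :: "real^'n"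
        using that by (auto simp: Basis_vec_def)
      have dim: "real DIM(real^'n) = n" by (simp add: n_def)
      have "(\<integral>x. \<bar>v x\<bar> powr q \<partial>lborel) powr (1 / q)
         \<le> p * (real DIM(real^'n) - 1) / (real DIM(real^'n) - p) *
            (\<integral>x. (\<Sum>j\<in>UNIV. \<bar>g j x\<bar>) powr p \<partial>lborel) powr (1 / p)"
      proof (rule gagliardo_nirenberg_sobolev[where D = "\<lambda>x. frechet_derivative v (at x)" and R = R])
        show "(v has_derivative frechet_derivative v (at x)) (at x)" for x
          using v by (simp add: frechet_derivative_works[symmetric] smooth_imp_differentiable)
        show "continuous_on UNIV (\<lambda>x. frechet_derivative v (at x) b)" if b: "b \<in> Basis" for b
        proof -
          obtain i where i: "b = axis i 1" using *[OF b] by blast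
          have "continuous_on UNIV (partial_deriv i v)"
            using v by (intro smooth_imp_continuous smooth_partial_deriv)
          then show ?thesis by (simp add: i partial_deriv_def[abs_def])
        qed
        show "\<bar>frechet_derivative v (at x) b\<bar> \<le> (\<Sum>j\<in>UNIV. \<bar>g j x\<bar>)" if b: "b \<in> Basis" for x b
        proof -
          obtain i where i: "b = axis i 1" using *[OF b] by blast
          show ?thesis using dv_le[of i x] by (simp add: i partial_deriv_def)
        qed
        show "continuous_on UNIV (\<lambda>x. \<Sum>j\<in>UNIV. \<bar>g j x\<bar>)"
          using g_cont by (intro continuous_intros)
      qed (use n p q R dim in auto)
      then show ?thesis by (simp only: lebesgue_norm_def dim)
    qed
    also have "\<dots> \<le> p * (n - 1) / (n - p) * (N * N powr (1 / p) * (\<Sum>j\<in>UNIV. lebesgue_norm p (g j)))"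
      unfolding N_def using p n2 g_cont g_supp
      by (intro mult_left_mono lebesgue_norm_sum_le) auto
    also have "\<dots> = K * (\<Sum>j\<in>UNIV. lebesgue_norm p (g j))"
      by (simp add: K_def)
    also have "(\<Sum>j\<in>UNIV. lebesgue_norm p (g j)) =
        \<bar>\<beta>\<bar> * lebesgue_norm p (\<lambda>x. weight \<tau> x powr (\<beta> - 1) * f x) +
        (\<Sum>i\<in>UNIV. lebesgue_norm p (\<lambda>x. weight \<tau> x powr (\<beta> - 1) * boost \<tau> i f x))"
      using p by (simp add: UNIV_option_conv sum.reindex g_def[abs_def] lebesgue_norm_cmult)
    also have "\<dots> \<le> (\<bar>\<beta>\<bar> + 1) * (lebesgue_norm p (\<lambda>x. weight \<tau> x powr (\<beta> - 1) * f x) +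
        (\<Sum>i\<in>UNIV. lebesgue_norm p (\<lambda>x. weight \<tau> x powr (\<beta> - 1) * boost \<tau> i f x)))"
      by (simp add: algebra_simps sum_nonneg)
    finally show ?thesis using K by (simp add: v_def[abs_def] C_def mult.assoc mult_left_mono)
  qed
  show ?thesis
  proof (intro exI[of _ C] conjI)
    show "C \<ge> 0" using K by (simp add: C_def)
  qed (use main in blast)
qed

lemma sum_lists_Suc:
  fixes h :: "'n::finite list \<Rightarrow> real"
  shows "(\<Sum>is\<in>{is. length is = Suc j}. h is) = (\<Sum>is\<in>{is. length is = j}. \<Sum>i\<in>UNIV. h (i # is))"
proof -
  have eq: "{is :: 'n list. length is = Suc j} = (\<lambda>x. snd x # fst x) ` ({is. length is = j} \<times> UNIV)"
    by (auto simp: length_Suc_conv image_iff)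
  have "inj_on (\<lambda>x. snd x # fst x) ({is :: 'n list. length is = j} \<times> UNIV)"
    by (auto simp: inj_on_def)
  then show ?thesis
    by (simp add: eq sum.reindex sum.cartesian_product case_prod_beta comp_def)
qed

text \<open>
  Induction on \<open>k\<close>: with \<open>r = n p / (n - p)\<close> one has \<open>1 / r = 1 / p - 1 / n\<close>, so \<open>r\<close> and \<open>k\<close> lead to the
  same \<open>q\<close> as \<open>p\<close> and \<open>k + 1\<close>. The induction hypothesis for \<open>r\<close> and \<open>\<beta> + 1\<close> reduces the
  claim to norms with exponent \<open>r\<close> of at most \<open>k\<close> boosts, weighted by \<open>w\<^sup>\<beta>\<close>; the first-order inequality
  bounds these, at the cost of one more boost, by norms with exponent \<open>p\<close> and weight \<open>w\<^sup>\<beta>\<^sup>-\<^sup>1\<close>.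
\<close>

lemma weighted_sobolev_higher_order:
  fixes p \<beta> q :: real and k :: nat
  defines "n \<equiv> real CARD('n::finite)"
  assumes n: "CARD('n) \<ge> 2" and "p \<ge> 1" "real k * p < n" "q = n * p / (n - real k * p)"
  shows "\<exists>C\<ge>0. \<forall>\<tau>>0. \<forall>u :: real^'n \<Rightarrow> real. smooth u \<and> compactly_supported u \<longrightarrow>
    lebesgue_norm q (\<lambda>x. weight \<tau> x powr (\<beta> + real k - 1) * u x) \<le>
      C * (\<Sum>j\<le>k. \<Sum>is\<in>{is. length is = j}.
        lebesgue_norm p (\<lambda>x. weight \<tau> x powr (\<beta> - 1) * foldr (boost \<tau>) is u x))"
  using assms(3-)
proof (induction k arbitrary: p \<beta>)
  case 0
  have "q = p" using 0 n by (simp add: n_def)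
  then show ?case by (intro exI[of _ 1]) simp
next
  case (Suc k)
  have n2: "n \<ge> 2" using n by (simp add: n_def)
  have kp: "0 \<le> real k * p" "p + real k * p < n" using Suc.prems by (auto simp: algebra_simps)
  then have pn: "p < n" by linarith
  define r where "r = n * p / (n - p)"
  have r: "r \<ge> 1"
  proof -
    have "n - p \<le> n * p" using Suc.prems n2 mult_left_mono[of 1 p n] by linarith
    then show ?thesis using pn by (simp add: r_def)
  qed
  have kr: "real k * r < n"
  proof -
    have "real k * p < n - p" using kp by simp
    then have "n * (real k * p) < n * (n - p)" using n2 by (intro mult_strict_left_mono) auto
    then show ?thesis using pn by (simp add: r_def pos_divide_less_eq mult_ac)
  qed
  have qr: "q = n * r / (n - real k * r)"
  proof -
    have "n - real k * r = n * (n - real (Suc k) * p) / (n - p)"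
      using pn by (simp add: r_def field_simps)
    then show ?thesis
      using pn n2 Suc.prems by (simp add: r_def)
  qed
  obtain C where C: "C \<ge> 0" and C_le: "\<And>\<tau> u :: real^'n \<Rightarrow> real. \<tau> > 0 \<Longrightarrow> smooth u \<Longrightarrow> compactly_supported u \<Longrightarrow>
    lebesgue_norm q (\<lambda>x. weight \<tau> x powr (\<beta> + 1 + real k - 1) * u x) \<le>
      C * (\<Sum>j\<le>k. \<Sum>is\<in>{is. length is = j}.
        lebesgue_norm r (\<lambda>x. weight \<tau> x powr (\<beta> + 1 - 1) * foldr (boost \<tau>) is u x))"
    using Suc.IH[OF r kr qr, of "\<beta> + 1"] by blast
  obtain B where B: "B \<ge> 0" and B_le: "\<And>\<tau> f :: real^'n \<Rightarrow> real. \<tau> > 0 \<Longrightarrow> smooth f \<Longrightarrow> compactly_supported f \<Longrightarrow>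
    lebesgue_norm r (\<lambda>x. weight \<tau> x powr \<beta> * f x) \<le>
      B * (lebesgue_norm p (\<lambda>x. weight \<tau> x powr (\<beta> - 1) * f x) +
           (\<Sum>i\<in>UNIV. lebesgue_norm p (\<lambda>x. weight \<tau> x powr (\<beta> - 1) * boost \<tau> i f x)))"
    using weighted_sobolev_first_order[OF n Suc.prems(1) pn[unfolded n_def] r_def[unfolded n_def], of \<beta>] by blast
  have "lebesgue_norm q (\<lambda>x. weight \<tau> x powr (\<beta> + real (Suc k) - 1) * u x) \<le>
      2 * C * B * (\<Sum>j\<le>Suc k. \<Sum>is\<in>{is. length is = j}.
        lebesgue_norm p (\<lambda>x. weight \<tau> x powr (\<beta> - 1) * foldr (boost \<tau>) is u x))"
    if \<tau>: "\<tau> > 0" and u: "smooth u" "compactly_supported u" for \<tau> and u :: "real^'n \<Rightarrow> real"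
  proof -
    define a where "a is = lebesgue_norm p (\<lambda>x. weight \<tau> x powr (\<beta> - 1) * foldr (boost \<tau>) is u x)" for "is"
    define S where "S j = (\<Sum>is\<in>{is. length is = j}. a is)" for j
    have S: "S j \<ge> 0" for j unfolding S_def a_def by (intro sum_nonneg) simp
    have "lebesgue_norm q (\<lambda>x. weight \<tau> x powr (\<beta> + real (Suc k) - 1) * u x) \<le>
      C * (\<Sum>j\<le>k. \<Sum>is\<in>{is. length is = j}.
        lebesgue_norm r (\<lambda>x. weight \<tau> x powr \<beta> * foldr (boost \<tau>) is u x))"
      using C_le[OF \<tau> u] by (simp add: add_ac)
    also have "\<dots> \<le> C * (\<Sum>j\<le>k. \<Sum>is\<in>{is. length is = j}. B * (a is + (\<Sum>i\<in>UNIV. a (i # is))))"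
    proof (intro mult_left_mono sum_mono C)
      fix "is" :: "'n list"
      show "lebesgue_norm r (\<lambda>x. weight \<tau> x powr \<beta> * foldr (boost \<tau>) is u x) \<le>
          B * (a is + (\<Sum>i\<in>UNIV. a (i # is)))"
        using B_le[OF \<tau> smooth_compactly_supported_boosts[OF \<tau> u]] by (simp add: a_def)
    qed
    also have "\<dots> = C * B * ((\<Sum>j\<le>k. S j) + (\<Sum>j\<le>k. S (Suc j)))"
      by (simp add: S_def sum_lists_Suc sum.distrib sum_distrib_left mult.assoc distrib_left)
    also have "\<dots> \<le> C * B * ((\<Sum>j\<le>Suc k. S j) + (\<Sum>j\<le>Suc k. S j))"
    proof (intro mult_left_mono add_mono)
      show "(\<Sum>j\<le>k. S j) \<le> (\<Sum>j\<le>Suc k. S j)" using S by simp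
      show "(\<Sum>j\<le>k. S (Suc j)) \<le> (\<Sum>j\<le>Suc k. S j)"
        unfolding sum.atMost_Suc_shift using S by simp
    qed (use B C in auto)
    finally show ?thesis by (simp add: S_def a_def mult_ac)
  qed
  with B C show ?case by (intro exI[of _ "2 * C * B"]) auto
qed

text \<open>
  Because \<open>k / n + 1 / q = 1 / p\<close>, both sides carry the factor \<open>\<tau> powr (1 / p)\<close>.
\<close>

theorem mainTheorem3:
  fixes k :: nat and p \<beta> q :: real
  assumes "CARD('n::finite) \<ge> 2"
    and "p \<ge> 1"
    and "real k * p < real CARD('n)"
    and "q = real CARD('n) * p / (real CARD('n) - real k * p)"
  shows "\<exists>C. \<forall>\<tau>>0. \<forall>u :: real^'n \<Rightarrow> real. smooth u \<and> compactly_supported u \<longrightarrow>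
    \<tau> powr (real k / real CARD('n)) * Lnorm \<tau> q (1 - q + q * (\<beta> + real k)) u
      \<le> C * Wnorm \<tau> k p (1 - p + p * \<beta>) u"
proof -
  define n where "n = real CARD('n)"
  have n: "n > 0" by (simp add: n_def)
  have p: "p > 0" using assms(2) by simp
  have q: "q > 0" using assms p n by (simp add: n_def)
  have exponents: "real k / n + 1 / q = 1 / p"
  proof -
    have "1 / q = (n - real k * p) / (n * p)" using assms(4) by (simp add: n_def)
    then show ?thesis using n p by (simp add: field_simps)
  qed
  obtain C where C: "\<And>\<tau> u :: real^'n \<Rightarrow> real. \<tau> > 0 \<Longrightarrow> smooth u \<Longrightarrow> compactly_supported u \<Longrightarrow>
    lebesgue_norm q (\<lambda>x. weight \<tau> x powr (\<beta> + real k - 1) * u x) \<le>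
      C * (\<Sum>j\<le>k. \<Sum>is\<in>{is. length is = j}.
        lebesgue_norm p (\<lambda>x. weight \<tau> x powr (\<beta> - 1) * foldr (boost \<tau>) is u x))"
    using weighted_sobolev_higher_order[OF assms, of \<beta>] by blast
  have "\<tau> powr (real k / n) * Lnorm \<tau> q (1 - q + q * (\<beta> + real k)) u
      \<le> C * Wnorm \<tau> k p (1 - p + p * \<beta>) u"
    if \<tau>: "\<tau> > 0" and u: "smooth u" "compactly_supported u" for \<tau> and u :: "real^'n \<Rightarrow> real"
  proof -
    have meas: "foldr (boost \<tau>) is u \<in> borel_measurable borel" for "is"
      using smooth_compactly_supported_boosts(1)[OF \<tau> u]
      by (intro borel_measurable_continuous_onI smooth_imp_continuous)
    have "\<tau> powr (real k / n) * Lnorm \<tau> q (1 - q + q * (\<beta> + real k)) u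
        = \<tau> powr (1 / p) * lebesgue_norm q (\<lambda>x. weight \<tau> x powr (\<beta> + real k - 1) * u x)"
      using Lnorm_eq_lebesgue_norm[OF \<tau> q, of u "\<beta> + real k"] meas[of "[]"] exponents
      by (simp add: mult.assoc[symmetric] powr_add[symmetric])
    also have "\<dots> \<le> \<tau> powr (1 / p) * (C * (\<Sum>j\<le>k. \<Sum>is\<in>{is. length is = j}.
        lebesgue_norm p (\<lambda>x. weight \<tau> x powr (\<beta> - 1) * foldr (boost \<tau>) is u x)))"
      using C[OF \<tau> u] by (intro mult_left_mono) auto
    also have "\<dots> = C * Wnorm \<tau> k p (1 - p + p * \<beta>) u"
      unfolding Wnorm_def hom_Wnorm_def Lnorm_eq_lebesgue_norm[OF \<tau> p meas]
      by (simp add: sum_distrib_left mult_ac)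
    finally show ?thesis .
  qed
  then show ?thesis unfolding n_def by blast
qed

end
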